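(* Let $\mathcal L=\text{nmod-}\mathcal M$ or $\text{mod-}\Lambda$, let $Z(x)=a\cdot x+i\,b\cdot x$ be a linear stability function for $\mathcal L$ with corresponding path $\gamma_Z(t)=tb-a$, and let $M$ be a nonzero object of $\mathcal L$. Then $M$ is $Z$-semistable, resp. $Z$-stable, if and only if $\gamma_Z(t)\in D(M)$, resp. $\gamma_Z(t)\in \mathrm{int}\,D(M)$, for some $t\in\mathbb R$. Furthermore, in that case, $t=\mu_Z(M)$.
   Context: Let $K$ be a field. $\mathcal L$ is either (i) $\text{mod-}\Lambda$, the category of finite dimensional right modules over a finite dimensional $K$-algebra $\Lambda$, or (ii) $\text{nmod-}\mathcal M$, where $\mathcal M=(\{F_i\}_{i=1}^n,\{M_{ij}\})$ is a modulated quiver over $K$ (the $F_i$ are finite dimensional division algebras over $K$, the $M_{ij}$ finite dimensional $F_i$-$F_j$-bimodules), $T\mathcal M=\coprod_{k\ge0}T_k\mathcal M$ is its tensor algebra ($T_0\mathcal M=\prod F_i$, $T_k\mathcal M=\coprod M_{j_0j_1}\otimes_{F_{j_1}}\cdots\otimes_{F_{j_{k-1}}} M_{j_{k-1}j_k}$), and $\text{nmod-}\mathcal M$ is the category of finitely generated right $T\mathcal M$-modules on which the ideal $R\mathcal M=\coprod_{k\ge1}T_k\mathcal M$ acts nilpotently. $\mathcal L$ has $n$ simple objects $S_1,\dots,S_n$; $\underline{\dim}\,M\in\mathbb N^n$ records the multiplicities of the $S_i$ in a composition series of $M$, and $K_0\mathcal L=\mathbb Z^n$ via $[M]\mapsto\underline{\dim}\,M$.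 A linear stability function for $\mathcal L$ is an additive map $Z:K_0\mathcal L\to\mathbb C$, $Z(x)=a\cdot x+i\,b\cdot x$, with $a\in\mathbb R^n$, $b\in(0,\infty)^n$ fixed. The slope of $M\ne0$ is $\mu_Z(M)=\frac{a\cdot\underline{\dim}\,M}{b\cdot\underline{\dim}\,M}$. A nonzero object $M$ is $Z$-semistable, resp. $Z$-stable, if $\mu_Z(M')\ge\mu_Z(M)$, resp. $\mu_Z(M')>\mu_Z(M)$, for all nonzero submodules $M'\subsetneq M$. $H(M)=\{x\in\mathbb R^n:x\cdot\underline{\dim}\,M=0\}$; $D(M)=\{x\in H(M):x\cdot\underline{\dim}\,M'\le0\text{ for all }M'\subseteq M\}$; $\mathrm{int}\,D(M)$ is the set of $x\in D(M)$ with $x\cdot\underline{\dim}\,M'<0$ for all nonzero proper submodules $M'\subsetneq M$. *)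

theory Defs
  imports
    "Jordan_Normal_Form.Missing_VectorSpace"
    "HOL-Algebra.QuotRing"
    "HOL-Algebra.Free_Abelian_Groups"
    "HOL-Analysis.Analysis"
begin

section \<open>Right modules and bimodules over noncommutative rings\<close>

text \<open>As in \<open>HOL-Algebra.Module\<close>, the underlying abelian group is the additive part of a
  ring record; the fields \<open>mult\<close> and \<open>one\<close> carry no meaning for a module.\<close>

record ('a, 'm) rmodule = "'m ring" +
  ract :: "'m \<Rightarrow> 'a \<Rightarrow> 'm" (infixl \<open>\<triangleleft>\<index>\<close> 70)

locale right_module = A?: ring A + M?: abelian_group M
  for A :: "('a, 'r) ring_scheme" (structure)
    and M :: "('a, 'm, 'x) rmodule_scheme" (structure) +
  assumes ract_closed: "\<lbrakk>x \<in> carrier M; a \<in> carrier A\<rbrakk> \<Longrightarrow> x \<triangleleft>\<^bsub>M\<^esub> a \<in> carrier M"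
    and ract_add_left: "\<lbrakk>x \<in> carrier M; y \<in> carrier M; a \<in> carrier A\<rbrakk>
      \<Longrightarrow> (x \<oplus>\<^bsub>M\<^esub> y) \<triangleleft>\<^bsub>M\<^esub> a = x \<triangleleft>\<^bsub>M\<^esub> a \<oplus>\<^bsub>M\<^esub> y \<triangleleft>\<^bsub>M\<^esub> a"
    and ract_add_right: "\<lbrakk>x \<in> carrier M; a \<in> carrier A; b \<in> carrier A\<rbrakk>
      \<Longrightarrow> x \<triangleleft>\<^bsub>M\<^esub> (a \<oplus>\<^bsub>A\<^esub> b) = x \<triangleleft>\<^bsub>M\<^esub> a \<oplus>\<^bsub>M\<^esub> x \<triangleleft>\<^bsub>M\<^esub> b"
    and ract_assoc: "\<lbrakk>x \<in> carrier M; a \<in> carrier A; b \<in> carrier A\<rbrakk>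
      \<Longrightarrow> x \<triangleleft>\<^bsub>M\<^esub> (a \<otimes>\<^bsub>A\<^esub> b) = (x \<triangleleft>\<^bsub>M\<^esub> a) \<triangleleft>\<^bsub>M\<^esub> b"
    and ract_one: "x \<in> carrier M \<Longrightarrow> x \<triangleleft>\<^bsub>M\<^esub> \<one>\<^bsub>A\<^esub> = x"

definition rsubmodule ::
    "('a, 'r) ring_scheme \<Rightarrow> ('a, 'm, 'x) rmodule_scheme \<Rightarrow> 'm set \<Rightarrow> bool" where
  "rsubmodule A M N \<longleftrightarrow>
     additive_subgroup N M \<and> (\<forall>x\<in>N. \<forall>a\<in>carrier A. x \<triangleleft>\<^bsub>M\<^esub> a \<in> N)"

definition quot_rmodule :: "('a, 'm, 'x) rmodule_scheme \<Rightarrow> 'm set \<Rightarrow> ('a, 'm set) rmodule" where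
  "quot_rmodule M N =
     \<lparr>carrier = a_rcosets\<^bsub>M\<^esub> N, monoid.mult = undefined, monoid.one = undefined,
      ring.zero = N, ring.add = set_add M, ract = (\<lambda>X a. \<Union>x\<in>X. N +>\<^bsub>M\<^esub> (x \<triangleleft>\<^bsub>M\<^esub> a))\<rparr>"

definition rmodule_iso ::
    "('a, 'r) ring_scheme \<Rightarrow> ('a, 'm, 'x) rmodule_scheme \<Rightarrow> ('a, 'l, 'y) rmodule_scheme \<Rightarrow> bool" where
  "rmodule_iso A M N \<longleftrightarrow>
     (\<exists>h. bij_betw h (carrier M) (carrier N) \<and>
          (\<forall>x\<in>carrier M. \<forall>y\<in>carrier M. h (x \<oplus>\<^bsub>M\<^esub> y) = h x \<oplus>\<^bsub>N\<^esub> h y) \<and>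
          (\<forall>x\<in>carrier M. \<forall>a\<in>carrier A. h (x \<triangleleft>\<^bsub>M\<^esub> a) = h x \<triangleleft>\<^bsub>N\<^esub> a))"

definition rmodule_simple :: "('a, 'r) ring_scheme \<Rightarrow> ('a, 'm, 'x) rmodule_scheme \<Rightarrow> bool" where
  "rmodule_simple A M \<longleftrightarrow>
     carrier M \<noteq> {\<zero>\<^bsub>M\<^esub>} \<and> (\<forall>N. rsubmodule A M N \<longrightarrow> N = {\<zero>\<^bsub>M\<^esub>} \<or> N = carrier M)"

definition rmodule_fin_gen :: "('a, 'r) ring_scheme \<Rightarrow> ('a, 'm, 'x) rmodule_scheme \<Rightarrow> bool" where
  "rmodule_fin_gen A M \<longleftrightarrow>
     (\<exists>X. finite X \<and> X \<subseteq> carrier M \<and> (\<forall>N. rsubmodule A M N \<and> X \<subseteq> N \<longrightarrow> N = carrier M))"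

text \<open>Both rings acting on a bimodule have the same carrier type, because the division algebras
  of a modulated quiver are a single family of records.\<close>

record ('a, 'm) bimodule = "('a, 'm) rmodule" +
  lact :: "'a \<Rightarrow> 'm \<Rightarrow> 'm" (infixr \<open>\<triangleright>\<index>\<close> 70)

locale bimodule = right_module B V + L?: ring A
  for A :: "('a, 'q) ring_scheme" (structure)
    and B :: "('a, 'r) ring_scheme" (structure)
    and V :: "('a, 'm, 'x) bimodule_scheme" (structure) +
  assumes lact_closed: "\<lbrakk>a \<in> carrier A; x \<in> carrier V\<rbrakk> \<Longrightarrow> a \<triangleright>\<^bsub>V\<^esub> x \<in> carrier V"
    and lact_add_right: "\<lbrakk>a \<in> carrier A; x \<in> carrier V; y \<in> carrier V\<rbrakk>
      \<Longrightarrow> a \<triangleright>\<^bsub>V\<^esub> (x \<oplus>\<^bsub>V\<^esub> y) = (a \<triangleright>\<^bsub>V\<^esub> x) \<oplus>\<^bsub>V\<^esub> (a \<triangleright>\<^bsub>V\<^esub> y)"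
    and lact_add_left: "\<lbrakk>a \<in> carrier A; b \<in> carrier A; x \<in> carrier V\<rbrakk>
      \<Longrightarrow> (a \<oplus>\<^bsub>A\<^esub> b) \<triangleright>\<^bsub>V\<^esub> x = (a \<triangleright>\<^bsub>V\<^esub> x) \<oplus>\<^bsub>V\<^esub> (b \<triangleright>\<^bsub>V\<^esub> x)"
    and lact_assoc: "\<lbrakk>a \<in> carrier A; b \<in> carrier A; x \<in> carrier V\<rbrakk>
      \<Longrightarrow> (a \<otimes>\<^bsub>A\<^esub> b) \<triangleright>\<^bsub>V\<^esub> x = a \<triangleright>\<^bsub>V\<^esub> (b \<triangleright>\<^bsub>V\<^esub> x)"
    and lact_one: "x \<in> carrier V \<Longrightarrow> \<one>\<^bsub>A\<^esub> \<triangleright>\<^bsub>V\<^esub> x = x"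
    and lact_ract: "\<lbrakk>a \<in> carrier A; x \<in> carrier V; b \<in> carrier B\<rbrakk>
      \<Longrightarrow> (a \<triangleright>\<^bsub>V\<^esub> x) \<triangleleft>\<^bsub>V\<^esub> b = a \<triangleright>\<^bsub>V\<^esub> (x \<triangleleft>\<^bsub>V\<^esub> b)"


section \<open>Finite dimensional algebras\<close>

text \<open>The locale \<open>algebra\<close> of \<open>HOL-Algebra\<close> is restricted to commutative algebras.\<close>

locale fd_algebra = vectorspace K A + A: ring A for K :: "('k, 'kx) ring_scheme" and A :: "('k, 'a, 'r) module_scheme" (structure) +
  assumes smult_mult_left: "\<lbrakk>k \<in> carrier K; x \<in> carrier A; y \<in> carrier A\<rbrakk>
      \<Longrightarrow> (k \<odot>\<^bsub>A\<^esub> x) \<otimes>\<^bsub>A\<^esub> y = k \<odot>\<^bsub>A\<^esub> (x \<otimes>\<^bsub>A\<^esub> y)"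
    and smult_mult_right: "\<lbrakk>k \<in> carrier K; x \<in> carrier A; y \<in> carrier A\<rbrakk>
      \<Longrightarrow> x \<otimes>\<^bsub>A\<^esub> (k \<odot>\<^bsub>A\<^esub> y) = k \<odot>\<^bsub>A\<^esub> (x \<otimes>\<^bsub>A\<^esub> y)"
    and finite_dimensional: "fin_dim"

text \<open>The \<open>K\<close>-vector spaces underlying a right module over a \<open>K\<close>-algebra and a bimodule whose
  left acting ring is a \<open>K\<close>-algebra, with \<open>K\<close> acting through \<open>k \<mapsto> k\<cdot>1\<close>.\<close>

definition right_scalars ::
    "('k, 'a, 'r) module_scheme \<Rightarrow> ('a, 'm, 'x) rmodule_scheme \<Rightarrow> ('k, 'm) module" where
  "right_scalars A M =
     \<lparr>carrier = carrier M, monoid.mult = monoid.mult M, monoid.one = monoid.one M,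
      ring.zero = ring.zero M, ring.add = ring.add M,
      module.smult = (\<lambda>k x. x \<triangleleft>\<^bsub>M\<^esub> (k \<odot>\<^bsub>A\<^esub> \<one>\<^bsub>A\<^esub>))\<rparr>"

definition left_scalars ::
    "('k, 'a, 'r) module_scheme \<Rightarrow> ('a, 'm, 'x) bimodule_scheme \<Rightarrow> ('k, 'm) module" where
  "left_scalars A V =
     \<lparr>carrier = carrier V, monoid.mult = monoid.mult V, monoid.one = monoid.one V,
      ring.zero = ring.zero V, ring.add = ring.add V,
      module.smult = (\<lambda>k x. (k \<odot>\<^bsub>A\<^esub> \<one>\<^bsub>A\<^esub>) \<triangleright>\<^bsub>V\<^esub> x)\<rparr>"


section \<open>Modulated quivers and their tensor algebras\<close>

text \<open>The vertices are the elements of a finite type.  The last but one assumption says that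
  the two actions of \<open>K\<close> on \<open>E i j\<close> agree, so that \<open>E i j\<close> is one vector space over \<open>K\<close>.\<close>

locale modulated_quiver = field K
  for K :: "('k, 'kx) ring_scheme" (structure)
    and F :: "'n::finite \<Rightarrow> ('k, 'f) module"
    and E :: "'n \<Rightarrow> 'n \<Rightarrow> ('f, 'e) bimodule" +
  assumes F_algebra: "fd_algebra K (F i)"
    and F_division: "Units (F i) = carrier (F i) - {\<zero>\<^bsub>F i\<^esub>}"
    and E_bimodule: "bimodule (F i) (F j) (E i j)"
    and E_central: "\<lbrakk>k \<in> carrier K; x \<in> carrier (E i j)\<rbrakk>
      \<Longrightarrow> (k \<odot>\<^bsub>F i\<^esub> \<one>\<^bsub>F i\<^esub>) \<triangleright>\<^bsub>E i j\<^esub> x = x \<triangleleft>\<^bsub>E i j\<^esub> (k \<odot>\<^bsub>F j\<^esub> \<one>\<^bsub>F j\<^esub>)"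
    and E_fin_dim: "vectorspace.fin_dim K (left_scalars (F i) (E i j))"

text \<open>\<open>Scalar i f\<close> stands for \<open>f\<close> in the factor \<open>F i\<close> of \<open>T\<^sub>0\<close>, and
  \<open>Tensor [(j\<^sub>0,j\<^sub>1,x\<^sub>1), (j\<^sub>1,j\<^sub>2,x\<^sub>2), \<dots>, (j\<^sub>k\<^sub>-\<^sub>1,j\<^sub>k,x\<^sub>k)]\<close> for the pure tensor
  \<open>x\<^sub>1 \<otimes> \<dots> \<otimes> x\<^sub>k\<close> in the summand \<open>E j\<^sub>0 j\<^sub>1 \<otimes> \<dots> \<otimes> E j\<^sub>k\<^sub>-\<^sub>1 j\<^sub>k\<close> of \<open>T\<^sub>k\<close>.\<close>

datatype ('n, 'f, 'e) tensor_word = Scalar 'n 'f | Tensor "('n \<times> 'n \<times> 'e) list"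

primrec degree_word :: "('n, 'f, 'e) tensor_word \<Rightarrow> nat" where
  "degree_word (Scalar i f) = 0"
| "degree_word (Tensor p) = length p"

definition composable :: "('n \<Rightarrow> 'n \<Rightarrow> ('f, 'e) bimodule) \<Rightarrow> ('n \<times> 'n \<times> 'e) list \<Rightarrow> bool" where
  "composable E p \<longleftrightarrow> (\<forall>(i, j, x)\<in>set p. x \<in> carrier (E i j)) \<and>
     successively (\<lambda>(i, j, x) (k, l, y). j = k) p"

definition tensor_words ::
    "('n \<Rightarrow> ('k, 'f) module) \<Rightarrow> ('n \<Rightarrow> 'n \<Rightarrow> ('f, 'e) bimodule) \<Rightarrow> ('n, 'f, 'e) tensor_word set" where
  "tensor_words F E =
     {Scalar i f | i f. f \<in> carrier (F i)} \<union>
     {Tensor p | p. p \<noteq> [] \<and> composable E p}"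

text \<open>Additivity of scalars, additivity of pure tensors in each argument, and balancedness.\<close>

definition tensor_relations ::
    "('n \<Rightarrow> ('k, 'f) module) \<Rightarrow> ('n \<Rightarrow> 'n \<Rightarrow> ('f, 'e) bimodule)
     \<Rightarrow> (('n, 'f, 'e) tensor_word \<Rightarrow>\<^sub>0 int) set" where
  "tensor_relations F E =
     {frag_of (Scalar i (f \<oplus>\<^bsub>F i\<^esub> g)) - frag_of (Scalar i f) - frag_of (Scalar i g) | i f g.
        f \<in> carrier (F i) \<and> g \<in> carrier (F i)} \<union>
     {frag_of (Tensor (p @ (i, j, x \<oplus>\<^bsub>E i j\<^esub> y) # q))
        - frag_of (Tensor (p @ (i, j, x) # q)) - frag_of (Tensor (p @ (i, j, y) # q)) | p q i j x y.
        Tensor (p @ (i, j, x) # q) \<in> tensor_words F E \<and>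
        Tensor (p @ (i, j, y) # q) \<in> tensor_words F E} \<union>
     {frag_of (Tensor (p @ (i, j, x \<triangleleft>\<^bsub>E i j\<^esub> f) # (j, l, y) # q))
        - frag_of (Tensor (p @ (i, j, x) # (j, l, f \<triangleright>\<^bsub>E j l\<^esub> y) # q)) | p q i j l x y f.
        Tensor (p @ (i, j, x) # (j, l, y) # q) \<in> tensor_words F E \<and> f \<in> carrier (F j)}"

definition tensor_null ::
    "('n \<Rightarrow> ('k, 'f) module) \<Rightarrow> ('n \<Rightarrow> 'n \<Rightarrow> ('f, 'e) bimodule)
     \<Rightarrow> (('n, 'f, 'e) tensor_word \<Rightarrow>\<^sub>0 int) set" where
  "tensor_null F E = generate (free_Abelian_group (tensor_words F E)) (tensor_relations F E)"

fun word_mult ::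
    "('n \<Rightarrow> ('k, 'f) module) \<Rightarrow> ('n \<Rightarrow> 'n \<Rightarrow> ('f, 'e) bimodule)
     \<Rightarrow> ('n, 'f, 'e) tensor_word \<Rightarrow> ('n, 'f, 'e) tensor_word \<Rightarrow> ('n, 'f, 'e) tensor_word \<Rightarrow>\<^sub>0 int" where
  "word_mult F E (Scalar i f) (Scalar j g) =
     (if i = j then frag_of (Scalar i (f \<otimes>\<^bsub>F i\<^esub> g)) else 0)"
| "word_mult F E (Scalar i f) (Tensor q) =
     (case hd q of (j, l, y) \<Rightarrow>
        if i = j then frag_of (Tensor ((j, l, f \<triangleright>\<^bsub>E j l\<^esub> y) # tl q)) else 0)"
| "word_mult F E (Tensor p) (Scalar k g) =
     (case last p of (i, j, x) \<Rightarrow>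
        if j = k then frag_of (Tensor (butlast p @ [(i, j, x \<triangleleft>\<^bsub>E i j\<^esub> g)])) else 0)"
| "word_mult F E (Tensor p) (Tensor q) =
     (if fst (snd (last p)) = fst (hd q) then frag_of (Tensor (p @ q)) else 0)"

definition tensor_mult ::
    "('n \<Rightarrow> ('k, 'f) module) \<Rightarrow> ('n \<Rightarrow> 'n \<Rightarrow> ('f, 'e) bimodule)
     \<Rightarrow> (('n, 'f, 'e) tensor_word \<Rightarrow>\<^sub>0 int) \<Rightarrow> (('n, 'f, 'e) tensor_word \<Rightarrow>\<^sub>0 int)
     \<Rightarrow> (('n, 'f, 'e) tensor_word \<Rightarrow>\<^sub>0 int)" where
  "tensor_mult F E u v = frag_extend (\<lambda>w. frag_extend (word_mult F E w) v) u"

text \<open>A direct sum of tensor products is the free abelian group on all pure tensors of all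
  summands modulo the defining relations of each summand; in degree \<open>0\<close> the relations leave
  \<open>\<Oplus>\<^sub>i F i\<close>, which is \<open>\<Prod>\<^sub>i F i\<close> because there are finitely many vertices.\<close>

definition tensor_algebra ::
    "('n::finite \<Rightarrow> ('k, 'f) module) \<Rightarrow> ('n \<Rightarrow> 'n \<Rightarrow> ('f, 'e) bimodule)
     \<Rightarrow> (('n, 'f, 'e) tensor_word \<Rightarrow>\<^sub>0 int) set ring" where
  "tensor_algebra F E =
     (let G = free_Abelian_group (tensor_words F E); N = tensor_null F E in
      \<lparr>carrier = carrier (G Mod N),
       monoid.mult = (\<lambda>X Y. \<Union>u\<in>X. \<Union>v\<in>Y. N #>\<^bsub>G\<^esub> tensor_mult F E u v),
       monoid.one = N #>\<^bsub>G\<^esub> (\<Sum>i\<in>UNIV. frag_of (Scalar i \<one>\<^bsub>F i\<^esub>)),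
       ring.zero = \<one>\<^bsub>G Mod N\<^esub>,
       ring.add = monoid.mult (G Mod N)\<rparr>)"

text \<open>The ideal \<open>R\<close>, the sum of all \<open>T\<^sub>k\<close> with \<open>k \<ge> 1\<close>.\<close>

definition tensor_radical ::
    "('n::finite \<Rightarrow> ('k, 'f) module) \<Rightarrow> ('n \<Rightarrow> 'n \<Rightarrow> ('f, 'e) bimodule)
     \<Rightarrow> (('n, 'f, 'e) tensor_word \<Rightarrow>\<^sub>0 int) set set" where
  "tensor_radical F E =
     {tensor_null F E #>\<^bsub>free_Abelian_group (tensor_words F E)\<^esub> u | u.
        Poly_Mapping.keys u \<subseteq> {w \<in> tensor_words F E. degree_word w \<ge> 1}}"


subsection \<open>The tensor algebra is a ring\<close>

lemma Scalar_in_tensor_words: "Scalar i f \<in> tensor_words F E \<longleftrightarrow> f \<in> carrier (F i)"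
  by (auto simp: tensor_words_def)

lemma Tensor_in_tensor_words: "Tensor p \<in> tensor_words F E \<longleftrightarrow> p \<noteq> [] \<and> composable E p"
  by (auto simp: tensor_words_def composable_def)

lemma composable_Nil: "composable E []" by (simp add: composable_def)

lemma composable_Cons: "composable E ((i,j,x) # q) \<longleftrightarrow> x \<in> carrier (E i j) \<and> composable E q \<and> (q \<noteq> [] \<longrightarrow> j = fst (hd q))"
  by (cases q) (auto simp: composable_def)

lemma composable_append: "composable E (p @ q) \<longleftrightarrow> composable E p \<and> composable E q \<and> (p \<noteq> [] \<and> q \<noteq> [] \<longrightarrow> fst (snd (last p)) = fst (hd q))"
  by (auto simp: composable_def successively_append_iff split: prod.splits)

lemmas composable_simps = composable_Nil composable_Cons composable_append

lemma frag_extend_fun_add: "frag_extend (\<lambda>w. f w + g w) u = frag_extend f u + frag_extend g u"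
  by (simp add: frag_extend_def frag_cmul_distrib2 sum.distrib)

lemma frag_cmul_diff2: "frag_cmul c (a - b) = frag_cmul c a - frag_cmul c b"
  by (simp add: poly_mapping_eqI lookup_minus right_diff_distrib)

lemma frag_extend_fun_diff: "frag_extend (\<lambda>w. f w - g w) u = frag_extend f u - frag_extend g u"
  by (simp add: frag_extend_def frag_cmul_diff2 sum_subtractf)

lemma tensor_mult_add_left: "tensor_mult F E (u + u') v = tensor_mult F E u v + tensor_mult F E u' v"
  by (simp add: tensor_mult_def frag_extend_add)
lemma tensor_mult_diff_left: "tensor_mult F E (u - u') v = tensor_mult F E u v - tensor_mult F E u' v"
  by (simp add: tensor_mult_def frag_extend_diff)
lemma tensor_mult_add_right: "tensor_mult F E u (v + v') = tensor_mult F E u v + tensor_mult F E u v'"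
  by (simp add: tensor_mult_def frag_extend_add frag_extend_fun_add)
lemma tensor_mult_diff_right: "tensor_mult F E u (v - v') = tensor_mult F E u v - tensor_mult F E u v'"
  by (simp add: tensor_mult_def frag_extend_diff frag_extend_fun_diff)
lemma tensor_mult_zero_left: "tensor_mult F E 0 v = 0"
  by (simp add: tensor_mult_def)
lemma tensor_mult_zero_right: "tensor_mult F E u 0 = 0"
  using tensor_mult_diff_right[of F E u 0 0] by simp
lemma tensor_mult_of: "tensor_mult F E (frag_of w) (frag_of w') = word_mult F E w w'"
  by (simp add: tensor_mult_def)

context modulated_quiver
begin

abbreviation "W \<equiv> tensor_words F E"
abbreviation "G \<equiv> free_Abelian_group W"
abbreviation "N \<equiv> tensor_null F E"
abbreviation "tm \<equiv> tensor_mult F E"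
abbreviation "wm \<equiv> word_mult F E"

lemma Fr: "ring (F i)" using F_algebra unfolding fd_algebra_def by blast
lemma Er: "right_module (F j) (E i j)" using E_bimodule unfolding bimodule_def by blast
lemma Eg: "abelian_group (E i j)" using Er unfolding right_module_def by blast

lemma F_add: "f \<in> carrier (F i) \<Longrightarrow> g \<in> carrier (F i) \<Longrightarrow> f \<oplus>\<^bsub>F i\<^esub> g \<in> carrier (F i)"
  using Fr ring.ring_simprules(1) by metis
lemma F_mult: "f \<in> carrier (F i) \<Longrightarrow> g \<in> carrier (F i) \<Longrightarrow> f \<otimes>\<^bsub>F i\<^esub> g \<in> carrier (F i)"
  using Fr ring.ring_simprules(5) by metis
lemma F_one: "\<one>\<^bsub>F i\<^esub> \<in> carrier (F i)" 
  using Fr ring.ring_simprules(6) by metis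
lemma E_add: "x \<in> carrier (E i j) \<Longrightarrow> y \<in> carrier (E i j) \<Longrightarrow> x \<oplus>\<^bsub>E i j\<^esub> y \<in> carrier (E i j)"
  by (meson Eg abelian_groupE(1))
lemma E_ract: "x \<in> carrier (E i j) \<Longrightarrow> f \<in> carrier (F j) \<Longrightarrow> x \<triangleleft>\<^bsub>E i j\<^esub> f \<in> carrier (E i j)"
  using Er right_module.ract_closed by metis
lemma E_lact: "x \<in> carrier (E i j) \<Longrightarrow> f \<in> carrier (F i) \<Longrightarrow> f \<triangleright>\<^bsub>E i j\<^esub> x \<in> carrier (E i j)"
  using E_bimodule bimodule.lact_closed by metis
lemmas cl = F_add F_mult F_one E_add E_ract E_lact

lemma hdE: assumes "Tensor q \<in> W" obtains j l y q' where "q = (j,l,y) # q'"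
  "y \<in> carrier (E j l)" "composable E q'" "q' \<noteq> [] \<longrightarrow> l = fst (hd q')"
  using assms by (cases q) (auto simp: Tensor_in_tensor_words composable_simps)

lemma lastE: assumes "Tensor q \<in> W" obtains j l y q' where "q = q' @ [(j,l,y)]"
  "y \<in> carrier (E j l)" "composable E q'" "q' \<noteq> [] \<longrightarrow> fst (snd (last q')) = j"
  using assms by (cases q rule: rev_cases) (auto simp: Tensor_in_tensor_words composable_simps)

lemma wm_closed: assumes "w \<in> W" "w' \<in> W" shows "Poly_Mapping.keys (wm w w') \<subseteq> W"
proof (cases w)
  case w: (Scalar i f)
  show ?thesis
  proof (cases w')
    case (Scalar j g)
    then show ?thesis using w assms by (auto simp: Scalar_in_tensor_words cl)
  next
    case (Tensor q)
    obtain j l y q' where "q = (j,l,y) # q'"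
  "y \<in> carrier (E j l)" "composable E q'" "q' \<noteq> [] \<longrightarrow> l = fst (hd q')"
      using hdE assms Tensor by metis
    then show ?thesis using w assms Tensor by (auto simp: Scalar_in_tensor_words Tensor_in_tensor_words composable_simps cl)
  qed
next
  case w: (Tensor p)
  show ?thesis
  proof (cases w')
    case (Scalar j g)
    obtain j l y q' where "p = q' @ [(j,l,y)]"
  "y \<in> carrier (E j l)" "composable E q'" "q' \<noteq> [] \<longrightarrow> fst (snd (last q')) = j"
      using lastE assms w by metis
    then show ?thesis using w assms Scalar by (auto simp: Scalar_in_tensor_words Tensor_in_tensor_words composable_simps cl)
  next
    case (Tensor q)
    then show ?thesis using w assms by (auto simp: Tensor_in_tensor_words composable_simps)
  qed
qed

lemma keysW_diff: "Poly_Mapping.keys a \<subseteq> W \<Longrightarrow> Poly_Mapping.keys b \<subseteq> W \<Longrightarrow> Poly_Mapping.keys (a - b) \<subseteq> W"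
  using keys_diff[of a b] by blast
lemma keysW_add: "Poly_Mapping.keys a \<subseteq> W \<Longrightarrow> Poly_Mapping.keys b \<subseteq> W \<Longrightarrow> Poly_Mapping.keys (a + b) \<subseteq> W"
  using keys_add[of a b] by blast

lemma tm_closed: assumes "Poly_Mapping.keys u \<subseteq> W" "Poly_Mapping.keys v \<subseteq> W"
  shows "Poly_Mapping.keys (tm u v) \<subseteq> W"
  using assms(1)
proof (induction u rule: frag_induction)
  case (one w)
  from assms(2) show ?case
  proof (induction v rule: frag_induction)
    case one': (one w')
    show ?case using wm_closed[OF one one'] by (simp add: tensor_mult_of)
  qed (simp_all add: tensor_mult_zero_right tensor_mult_diff_right keysW_diff)
qed (simp_all add: tensor_mult_zero_left tensor_mult_diff_left keysW_diff)

lemma rels_sub: "tensor_relations F E \<subseteq> carrier G"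
proof
  fix r assume "r \<in> tensor_relations F E"
  then have "Poly_Mapping.keys r \<subseteq> W"
    unfolding tensor_relations_def
    by (elim UnE CollectE exE conjE; hypsubst; intro keysW_diff)
      (auto simp: Scalar_in_tensor_words Tensor_in_tensor_words composable_simps cl)
  then show "r \<in> carrier G" by simp
qed

interpretation Gg: comm_group G by (rule abelian_free_Abelian_group)

lemma N_subgroup: "subgroup N G"
  unfolding tensor_null_def by (rule Gg.generate_is_subgroup[OF rels_sub])

lemma N_normal: "N \<lhd> G" using N_subgroup Gg.subgroup_imp_normal by blast

lemma N_sub: "n \<in> N \<Longrightarrow> Poly_Mapping.keys n \<subseteq> W"
  using subsetD[OF subgroup.subset[OF N_subgroup]] by simp

lemma N0: "0 \<in> N" using subgroup.one_closed[OF N_subgroup] by simp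
lemma N_add: "a \<in> N \<Longrightarrow> b \<in> N \<Longrightarrow> a + b \<in> N"
  using subgroup.m_closed[OF N_subgroup] by simp
lemma N_minus: "a \<in> N \<Longrightarrow> - a \<in> N"
  using subgroup.m_inv_closed[OF N_subgroup] by (metis N_sub inv_free_Abelian_group)
lemma N_diff: "a \<in> N \<Longrightarrow> b \<in> N \<Longrightarrow> a - b \<in> N"
  using N_add N_minus by (metis diff_conv_add_uminus)

lemma N_induct [consumes 1, case_names zero rel diff]:
  assumes "n \<in> N" "P 0" "\<And>r. r \<in> tensor_relations F E \<Longrightarrow> P r"
    "\<And>a b. P a \<Longrightarrow> P b \<Longrightarrow> P (a - b)"
  shows "P n"
proof -
  have m: "P (- a)" if "P a" for a using assms(4)[OF assms(2) that] by simp
  from assms(1) show ?thesis unfolding tensor_null_def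
  proof (induction rule: generate.induct)
    case (inv h)
    then show ?case using rels_sub m assms(3) by (metis carrier_free_Abelian_group_iff inv_free_Abelian_group subsetD)
  next
    case (eng a b) then show ?case using assms(4)[of a "- b"] m by simp
  qed (simp_all add: assms)
qed

lemma rel1: "f \<in> carrier (F i) \<Longrightarrow> g \<in> carrier (F i) \<Longrightarrow> 
   frag_of (Scalar i (f \<oplus>\<^bsub>F i\<^esub> g)) - frag_of (Scalar i f) - frag_of (Scalar i g) \<in> N"
  unfolding tensor_null_def tensor_relations_def by (rule generate.incl) blast
lemma rel2: assumes "Tensor (p @ (i, j, x) # q) \<in> W" "Tensor (p @ (i, j, y) # q) \<in> W"
  shows "frag_of (Tensor (p @ (i, j, x \<oplus>\<^bsub>E i j\<^esub> y) # q))
        - frag_of (Tensor (p @ (i, j, x) # q)) - frag_of (Tensor (p @ (i, j, y) # q)) \<in> N"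
  unfolding tensor_null_def tensor_relations_def by (rule generate.incl) (use assms in blast)
lemma rel3: assumes "Tensor (p @ (i, j, x) # (j, l, y) # q) \<in> W" "f \<in> carrier (F j)"
  shows "frag_of (Tensor (p @ (i, j, x \<triangleleft>\<^bsub>E i j\<^esub> f) # (j, l, y) # q))
        - frag_of (Tensor (p @ (i, j, x) # (j, l, f \<triangleright>\<^bsub>E j l\<^esub> y) # q)) \<in> N"
  unfolding tensor_null_def tensor_relations_def by (rule generate.incl) (use assms in blast)

lemmas Fdist = ring.ring_simprules(13,23)[OF Fr]

lemma tm_diff3: "tm (a - b - c) v = tm a v - tm b v - tm c v" "tm v (a - b - c) = tm v a - tm v b - tm v c"
  by (simp_all add: tensor_mult_diff_left tensor_mult_diff_right)

lemmas Elaws = bimodule.lact_add_right[OF E_bimodule] bimodule.lact_ract[OF E_bimodule]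
   bimodule.lact_assoc[OF E_bimodule] right_module.ract_add_left[OF Er] right_module.ract_assoc[OF Er]
   bimodule.lact_add_left[OF E_bimodule] right_module.ract_add_right[OF Er]
   bimodule.lact_one[OF E_bimodule] right_module.ract_one[OF Er]

lemma relword:
  assumes r: "r \<in> tensor_relations F E" and w: "w \<in> W"
  shows "tm r (frag_of w) \<in> N"
proof -
  from r consider
    (A) i f g where "f \<in> carrier (F i)" "g \<in> carrier (F i)"
      "r = frag_of (Scalar i (f \<oplus>\<^bsub>F i\<^esub> g)) - frag_of (Scalar i f) - frag_of (Scalar i g)"
  | (B) p q i j x y where "Tensor (p @ (i, j, x) # q) \<in> W" "Tensor (p @ (i, j, y) # q) \<in> W"
      "r = frag_of (Tensor (p @ (i, j, x \<oplus>\<^bsub>E i j\<^esub> y) # q))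
        - frag_of (Tensor (p @ (i, j, x) # q)) - frag_of (Tensor (p @ (i, j, y) # q))"
  | (C) p q i j l x y f where "Tensor (p @ (i, j, x) # (j, l, y) # q) \<in> W" "f \<in> carrier (F j)"
      "r = frag_of (Tensor (p @ (i, j, x \<triangleleft>\<^bsub>E i j\<^esub> f) # (j, l, y) # q))
        - frag_of (Tensor (p @ (i, j, x) # (j, l, f \<triangleright>\<^bsub>E j l\<^esub> y) # q))"
    unfolding tensor_relations_def by blast
  then show ?thesis
  proof cases
    case A
    show ?thesis
    proof (cases w)
      case (Scalar k h)
      with A w show ?thesis
        using rel1[of "f \<otimes>\<^bsub>F i\<^esub> h" i "g \<otimes>\<^bsub>F i\<^esub> h"]
        by (auto simp: tm_diff3 tensor_mult_of Scalar_in_tensor_words Fdist cl N0)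
    next
      case (Tensor s)
      obtain k l z s' where "s = (k,l,z) # s'"
         "z \<in> carrier (E k l)" "composable E s'" "s' \<noteq> [] \<longrightarrow> l = fst (hd s')"
        using hdE w Tensor by metis
      with A Tensor show ?thesis
        using rel2[of "[]" i l "f \<triangleright>\<^bsub>E i l\<^esub> z" s' "g \<triangleright>\<^bsub>E i l\<^esub> z"]
        by (auto simp: tm_diff3 tensor_mult_of Tensor_in_tensor_words composable_simps Elaws cl N0)
    qed
  next
    case B
    show ?thesis
    proof (cases w)
      case (Scalar k h)
      show ?thesis
      proof (cases q rule: rev_cases)
        case Nil
        with B Scalar w show ?thesis
          using rel2[of p i j "x \<triangleleft>\<^bsub>E i j\<^esub> h" "[]" "y \<triangleleft>\<^bsub>E i j\<^esub> h"]
          by (auto simp: tm_diff3 tensor_mult_of Scalar_in_tensor_words Tensor_in_tensor_words composable_simps Elaws cl N0)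
      next
        case (snoc q' c)
        obtain s t z where c: "c = (s,t,z)" by (cases c)
        show ?thesis 
          using rel2[of p i j x "q' @ [(s,t,z \<triangleleft>\<^bsub>E s t\<^esub> h)]" y] B Scalar w
          by (cases "q' = []") (auto simp: snoc c tm_diff3 tensor_mult_of Scalar_in_tensor_words Tensor_in_tensor_words composable_simps Elaws cl N0 butlast_append)
      qed
    next
      case (Tensor s)
      with B w show ?thesis using rel2[of p i j x "q @ s" y]
        by (auto simp: tm_diff3 tensor_mult_of Tensor_in_tensor_words composable_simps N0)
    qed
  next
    case C
    show ?thesis
    proof (cases w)
      case (Scalar k h)
      show ?thesis
      proof (cases q rule: rev_cases)
        case Nil
        with C Scalar w show ?thesis
          using rel3[of p i j x l "y \<triangleleft>\<^bsub>E j l\<^esub> h" "[]" f]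
          by (auto simp: tensor_mult_diff_left tensor_mult_of Scalar_in_tensor_words Tensor_in_tensor_words composable_simps Elaws cl N0 butlast_append)
      next
        case (snoc q' c)
        obtain s t z where c: "c = (s,t,z)" by (cases c)
        show ?thesis 
          using rel3[of p i j x l y "q' @ [(s,t,z \<triangleleft>\<^bsub>E s t\<^esub> h)]" f] C Scalar w
          by (cases "q' = []") (auto simp: snoc c tensor_mult_diff_left tensor_mult_of Scalar_in_tensor_words Tensor_in_tensor_words composable_simps Elaws cl N0 butlast_append)
      qed
    next
      case (Tensor s)
      with C w show ?thesis using rel3[of p i j x l y "q @ s" f]
        by (auto simp: tensor_mult_diff_left tensor_mult_of Tensor_in_tensor_words composable_simps N0)
    qed
  qed
qed

lemma wordrel:
  assumes r: "r \<in> tensor_relations F E" and w: "w \<in> W"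
  shows "tm (frag_of w) r \<in> N"
proof -
  from r consider
    (A) i f g where "f \<in> carrier (F i)" "g \<in> carrier (F i)"
      "r = frag_of (Scalar i (f \<oplus>\<^bsub>F i\<^esub> g)) - frag_of (Scalar i f) - frag_of (Scalar i g)"
  | (B) p q i j x y where "Tensor (p @ (i, j, x) # q) \<in> W" "Tensor (p @ (i, j, y) # q) \<in> W"
      "r = frag_of (Tensor (p @ (i, j, x \<oplus>\<^bsub>E i j\<^esub> y) # q))
        - frag_of (Tensor (p @ (i, j, x) # q)) - frag_of (Tensor (p @ (i, j, y) # q))"
  | (C) p q i j l x y f where "Tensor (p @ (i, j, x) # (j, l, y) # q) \<in> W" "f \<in> carrier (F j)"
      "r = frag_of (Tensor (p @ (i, j, x \<triangleleft>\<^bsub>E i j\<^esub> f) # (j, l, y) # q))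
        - frag_of (Tensor (p @ (i, j, x) # (j, l, f \<triangleright>\<^bsub>E j l\<^esub> y) # q))"
    unfolding tensor_relations_def by blast
  then show ?thesis
  proof cases
    case A
    show ?thesis
    proof (cases w)
      case (Scalar k h)
      with A w show ?thesis
        using rel1[of "h \<otimes>\<^bsub>F i\<^esub> f" i "h \<otimes>\<^bsub>F i\<^esub> g"]
        by (auto simp: tm_diff3 tensor_mult_of Scalar_in_tensor_words Fdist cl N0)
    next
      case (Tensor s)
      obtain k l z s' where "s = s' @ [(k,l,z)]"
         "z \<in> carrier (E k l)" "composable E s'" "s' \<noteq> [] \<longrightarrow> fst (snd (last s')) = k"
        using lastE w Tensor by metis
      with A Tensor show ?thesis
        using rel2[of "s'" k i "z \<triangleleft>\<^bsub>E k i\<^esub> f" "[]" "z \<triangleleft>\<^bsub>E k i\<^esub> g"]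
        by (auto simp: tm_diff3 tensor_mult_of Tensor_in_tensor_words composable_simps Elaws cl N0)
    qed
  next
    case B
    show ?thesis
    proof (cases w)
      case (Scalar k h)
      show ?thesis
      proof (cases p)
        case Nil
        with B Scalar w show ?thesis
          using rel2[of "[]" i j "h \<triangleright>\<^bsub>E i j\<^esub> x" q "h \<triangleright>\<^bsub>E i j\<^esub> y"]
          by (auto simp: tm_diff3 tensor_mult_of Scalar_in_tensor_words Tensor_in_tensor_words composable_simps Elaws cl N0)
      next
        case (Cons c p')
        obtain s t z where c: "c = (s,t,z)" by (cases c)
        show ?thesis 
          using rel2[of "(s,t,h \<triangleright>\<^bsub>E s t\<^esub> z) # p'" i j x q y] B Scalar w
          by (cases "p' = []") (auto simp: Cons c tm_diff3 tensor_mult_of Scalar_in_tensor_words Tensor_in_tensor_words composable_simps Elaws cl N0)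
      qed
    next
      case (Tensor s)
      with B w show ?thesis using rel2[of "s @ p" i j x "q" y]
        by (cases "p = []") (auto simp: tm_diff3 tensor_mult_of Tensor_in_tensor_words composable_simps N0)
    qed
  next
    case C
    show ?thesis
    proof (cases w)
      case (Scalar k h)
      show ?thesis
      proof (cases p)
        case Nil
        with C Scalar w show ?thesis
          using rel3[of p i j "h \<triangleright>\<^bsub>E i j\<^esub> x" l y q f]
          by (auto simp: tensor_mult_diff_right tensor_mult_of Scalar_in_tensor_words Tensor_in_tensor_words composable_simps Elaws cl N0)
      next
        case (Cons c p')
        obtain s t z where c: "c = (s,t,z)" by (cases c)
        show ?thesis 
          using rel3[of "(s,t,h \<triangleright>\<^bsub>E s t\<^esub> z) # p'" i j x l y q f] C Scalar w
          by (cases "p' = []") (auto simp: Cons c tensor_mult_diff_right tensor_mult_of Scalar_in_tensor_words Tensor_in_tensor_words composable_simps Elaws cl N0)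
      qed
    next
      case (Tensor s)
      with C w show ?thesis using rel3[of "s @ p" i j x l y "q" f]
        by (cases "p = []") (auto simp: tensor_mult_diff_right tensor_mult_of Tensor_in_tensor_words composable_simps N0)
    qed
  qed
qed

lemma N_right: assumes "n \<in> N" "Poly_Mapping.keys v \<subseteq> W" shows "tm n v \<in> N"
  using assms(2)
proof (induction v rule: frag_induction)
  case (one w)
  from assms(1) show ?case
    by (induction rule: N_induct) (simp_all add: relword one tensor_mult_diff_left tensor_mult_zero_left N0 N_diff)
qed (simp_all add: tensor_mult_zero_right tensor_mult_diff_right N0 N_diff)

lemma N_left: assumes "n \<in> N" "Poly_Mapping.keys v \<subseteq> W" shows "tm v n \<in> N"
  using assms(2)
proof (induction v rule: frag_induction)
  case (one w)
  from assms(1) show ?case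
    by (induction rule: N_induct) (simp_all add: wordrel one tensor_mult_diff_right tensor_mult_zero_right N0 N_diff)
qed (simp_all add: tensor_mult_zero_left tensor_mult_diff_left N0 N_diff)

lemma assoc_word:
  assumes "u \<in> W" "v \<in> W" "w \<in> W"
  shows "tm (wm u v) (frag_of w) - tm (frag_of u) (wm v w) \<in> N"
proof (cases u)
  case u: (Scalar i f)
  show ?thesis
  proof (cases v)
    case v: (Scalar j g)
    show ?thesis
    proof (cases w)
      case w: (Scalar k h)
      show ?thesis using assms u v w
        by (auto simp: tensor_mult_of Scalar_in_tensor_words N0 tensor_mult_zero_left tensor_mult_zero_right ring.ring_simprules(11)[OF Fr])
    next
      case w: (Tensor r)
      show ?thesis by (rule hdE[of r]) (use assms u v w in \<open>auto simp: tensor_mult_of Scalar_in_tensor_words N0 tensor_mult_zero_left tensor_mult_zero_right Elaws\<close>)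
    qed
  next
    case v: (Tensor q)
    show ?thesis
    proof (cases w)
      case w: (Scalar k h)
      obtain a b z q' where q: "q = (a,b,z) # q'" "z \<in> carrier (E a b)" using hdE assms v by metis
      show ?thesis
      proof (cases q' rule: rev_cases)
        case Nil
        show ?thesis using assms u v w q Nil by (auto simp: tensor_mult_of Scalar_in_tensor_words N0 tensor_mult_zero_left tensor_mult_zero_right Elaws)
      next
        case (snoc q'' c)
        then show ?thesis using assms u v w q by (auto simp: tensor_mult_of Scalar_in_tensor_words N0 tensor_mult_zero_left tensor_mult_zero_right Elaws split: prod.splits)
      qed
    next
      case w: (Tensor r)
      obtain a b z q' where q: "q = (a,b,z) # q'" "z \<in> carrier (E a b)" using hdE assms v by metis
      show ?thesis using assms u v w q
        by (cases "q' = []") (auto simp: tensor_mult_of Scalar_in_tensor_words N0 tensor_mult_zero_left tensor_mult_zero_right Elaws split: prod.splits)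
    qed
  qed
next
  case u: (Tensor p)
  obtain a b z p' where p: "p = p' @ [(a,b,z)]" "z \<in> carrier (E a b)" "composable E p'"
      "p' \<noteq> [] \<longrightarrow> fst (snd (last p')) = a" using lastE assms u by metis
  show ?thesis
  proof (cases v)
    case v: (Scalar j g)
    show ?thesis
    proof (cases w)
      case w: (Scalar k h)
      show ?thesis using assms u v w p
        by (auto simp: tensor_mult_of Scalar_in_tensor_words N0 tensor_mult_zero_left tensor_mult_zero_right Elaws)
    next
      case w: (Tensor r)
      obtain c d y r' where r: "r = (c,d,y) # r'" "y \<in> carrier (E c d)" "composable E r'"
         "r' \<noteq> [] \<longrightarrow> d = fst (hd r')" using hdE assms w by metis
      show ?thesis using assms u v w p r rel3[of p' a b z d y r' g]
        by (auto simp: tensor_mult_of Scalar_in_tensor_words Tensor_in_tensor_words composable_simps N0 tensor_mult_zero_left tensor_mult_zero_right Elaws)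
    qed
  next
    case v: (Tensor q)
    obtain c d y q' where q: "q = q' @ [(c,d,y)]" "y \<in> carrier (E c d)" "composable E q'"
      "q' \<noteq> [] \<longrightarrow> fst (snd (last q')) = c" using lastE assms v by metis
    show ?thesis
    proof (cases w)
      case w: (Scalar k h)
      show ?thesis using assms u v w p q
        by (cases "q' = []") (auto simp: tensor_mult_of Scalar_in_tensor_words N0 tensor_mult_zero_left tensor_mult_zero_right butlast_append)
    next
      case w: (Tensor r)
      show ?thesis using assms u v w p q
        by (cases "q' = []") (auto simp: tensor_mult_of Tensor_in_tensor_words N0 tensor_mult_zero_left tensor_mult_zero_right)
    qed
  qed
qed

lemma tm_assoc:
  assumes "Poly_Mapping.keys u \<subseteq> W" "Poly_Mapping.keys v \<subseteq> W" "Poly_Mapping.keys w \<subseteq> W"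
  shows "tm (tm u v) w - tm u (tm v w) \<in> N"
proof -
  have d: "(a - b) - (c - e) = (a - c) - (b - e)" for a b c e :: "('b, 'd, 'e) tensor_word \<Rightarrow>\<^sub>0 int" by simp
  from assms(1) show ?thesis
  proof (induction u rule: frag_induction)
    case u: (one u)
    from assms(2) show ?case
    proof (induction v rule: frag_induction)
      case v: (one v)
      from assms(3) show ?case
      proof (induction w rule: frag_induction)
        case w: (one w)
        show ?case using assoc_word[OF u v w] by (simp add: tensor_mult_of)
      next
        case (diff a b)
        then show ?case using N_diff[OF diff] by (simp add: tensor_mult_diff_right algebra_simps)
      qed (simp add: tensor_mult_zero_left tensor_mult_zero_right N0)
    next
      case (diff a b)
      then show ?case using N_diff[OF diff] by (simp add: tensor_mult_diff_right tensor_mult_diff_left algebra_simps)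
    qed (simp add: tensor_mult_zero_left tensor_mult_zero_right N0)
  next
    case (diff a b)
    then show ?case using N_diff[OF diff] by (simp add: tensor_mult_diff_left algebra_simps)
  qed (simp add: tensor_mult_zero_left N0)
qed

abbreviation "T1 \<equiv> (\<Sum>i\<in>UNIV. frag_of (Scalar i \<one>\<^bsub>F i\<^esub>))"

lemma tm_sum_left: "finite I \<Longrightarrow> tm (\<Sum>i\<in>I. g i) v = (\<Sum>i\<in>I. tm (g i) v)"
  by (induction I rule: finite_induct) (simp_all add: tensor_mult_zero_left tensor_mult_add_left)
lemma tm_sum_right: "finite I \<Longrightarrow> tm v (\<Sum>i\<in>I. g i) = (\<Sum>i\<in>I. tm v (g i))"
  by (induction I rule: finite_induct) (simp_all add: tensor_mult_zero_right tensor_mult_add_right)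

lemma T1_keys: "Poly_Mapping.keys T1 \<subseteq> W"
  by (rule order_trans[OF keys_sum]) (auto simp: Scalar_in_tensor_words cl)

lemma T1_left: assumes "Poly_Mapping.keys v \<subseteq> W" shows "tm T1 v = v"
  using assms
proof (induction v rule: frag_induction)
  case (one w)
  have "\<exists>j. \<forall>i. wm (Scalar i \<one>\<^bsub>F i\<^esub>) w = (if i = j then frag_of w else 0)"
  proof (cases w)
    case (Scalar j f)
    with one show ?thesis
      by (intro exI[of _ j]) (auto simp: Scalar_in_tensor_words monoid.l_one[OF ring.is_monoid[OF Fr]])
  next
    case (Tensor q)
    obtain k l z s' where "q = (k,l,z) # s'" "z \<in> carrier (E k l)" using hdE one Tensor by metis
    with Tensor show ?thesis
      by (intro exI[of _ k]) (auto simp: Elaws)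
  qed
  then obtain j where "\<And>i. wm (Scalar i \<one>\<^bsub>F i\<^esub>) w = (if i = j then frag_of w else 0)"
    by blast
  then show ?case by (simp add: tm_sum_left tensor_mult_of)
qed (simp_all add: tensor_mult_zero_right tensor_mult_diff_right)

lemma T1_right: assumes "Poly_Mapping.keys v \<subseteq> W" shows "tm v T1 = v"
  using assms
proof (induction v rule: frag_induction)
  case (one w)
  have "\<exists>j. \<forall>i. wm w (Scalar i \<one>\<^bsub>F i\<^esub>) = (if i = j then frag_of w else 0)"
  proof (cases w)
    case (Scalar j f)
    with one show ?thesis
      by (intro exI[of _ j]) (auto simp: Scalar_in_tensor_words monoid.r_one[OF ring.is_monoid[OF Fr]])
  next
    case (Tensor q)
    obtain k l z s' where "q = s' @ [(k,l,z)]" "z \<in> carrier (E k l)" using lastE one Tensor by metis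
    with Tensor show ?thesis
      by (intro exI[of _ l]) (auto simp: Elaws)
  qed
  then obtain j where "\<And>i. wm w (Scalar i \<one>\<^bsub>F i\<^esub>) = (if i = j then frag_of w else 0)"
    by blast
  then show ?case by (simp add: tm_sum_right tensor_mult_of)
qed (simp_all add: tensor_mult_zero_left tensor_mult_diff_left)

abbreviation "T \<equiv> tensor_algebra F E"
abbreviation "cs u \<equiv> N #>\<^bsub>G\<^esub> u"

lemma cs_eqI: assumes "Poly_Mapping.keys u \<subseteq> W" "Poly_Mapping.keys v \<subseteq> W" "u - v \<in> N"
  shows "cs u = cs v"
proof -
  have "u \<in> cs v" unfolding r_coset_def using assms(3) by (auto intro!: bexI[of _ "u - v"])
  then show ?thesis using Gg.repr_independence[of u N v] N_subgroup assms(2) by simp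
qed

lemma cs_mem: "u \<in> cs v \<Longrightarrow> \<exists>n\<in>N. u = n + v" by (auto simp: r_coset_def)
lemma cs_self: "v \<in> cs v" by (auto simp: r_coset_def intro!: bexI[of _ 0] N0)

lemma T_carrier: "carrier T = cs ` {u. Poly_Mapping.keys u \<subseteq> W}"
  by (auto simp: tensor_algebra_def Let_def FactGroup_def RCOSETS_def)

lemma T_add: "Poly_Mapping.keys u \<subseteq> W \<Longrightarrow> Poly_Mapping.keys v \<subseteq> W \<Longrightarrow> cs u \<oplus>\<^bsub>T\<^esub> cs v = cs (u + v)"
  using normal.rcos_sum[OF N_normal, of u v] by (simp add: tensor_algebra_def Let_def)

lemma T_zero: "\<zero>\<^bsub>T\<^esub> = cs 0"
  by (simp add: tensor_algebra_def Let_def r_coset_def)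

lemma T_one: "\<one>\<^bsub>T\<^esub> = cs T1"
  by (simp add: tensor_algebra_def Let_def)

lemma T_mult: assumes "Poly_Mapping.keys u \<subseteq> W" "Poly_Mapping.keys v \<subseteq> W"
  shows "cs u \<otimes>\<^bsub>T\<^esub> cs v = cs (tm u v)"
proof -
  have *: "cs (tm u' v') = cs (tm u v)" if A: "u' \<in> cs u" and B: "v' \<in> cs v" for u' v'
  proof -
    obtain n m where n: "n \<in> N" "u' = n + u" and m: "m \<in> N" "v' = m + v"
      using cs_mem[OF A] cs_mem[OF B] by blast
    have k: "Poly_Mapping.keys u' \<subseteq> W" "Poly_Mapping.keys v' \<subseteq> W"
      unfolding n(2) m(2) by (rule keysW_add[OF N_sub[OF n(1)] assms(1)], rule keysW_add[OF N_sub[OF m(1)] assms(2)])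
    have "tm u' v' - tm u v = tm n v' + tm u m"
      by (simp add: n m tensor_mult_add_left tensor_mult_add_right)
    also have "\<dots> \<in> N" by (rule N_add[OF N_right[OF n(1) k(2)] N_left[OF m(1) assms(1)]])
    finally show ?thesis by (rule cs_eqI[OF tm_closed[OF k] tm_closed[OF assms]])
  qed
  have "cs u \<otimes>\<^bsub>T\<^esub> cs v = (\<Union>u'\<in>cs u. \<Union>v'\<in>cs v. cs (tm u' v'))"
    by (simp add: tensor_algebra_def Let_def)
  also have "\<dots> = (\<Union>u'\<in>cs u. \<Union>v'\<in>cs v. cs (tm u v))" using * by simp
  also have "\<dots> = cs (tm u v)" using cs_self[of u] cs_self[of v] by force
  finally show ?thesis .
qed

theorem tensor_algebra_ring: "ring T"
proof (rule ringI)
  show "abelian_group T"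
  proof (rule abelian_groupI)
    fix x assume "x \<in> carrier T"
    then obtain u where "x = cs u" "Poly_Mapping.keys u \<subseteq> W" by (auto simp: T_carrier)
    then show "\<exists>y\<in>carrier T. y \<oplus>\<^bsub>T\<^esub> x = \<zero>\<^bsub>T\<^esub>"
      by (intro bexI[of _ "cs (- u)"]) (auto simp: T_carrier T_add T_zero)
  qed (auto simp: T_carrier T_add T_zero keysW_add ac_simps intro!: imageI keysW_add)
  show "monoid T"
  proof (rule monoidI)
    fix x y z assume "x \<in> carrier T" "y \<in> carrier T" "z \<in> carrier T"
    then obtain u v w where "x = cs u" "y = cs v" "z = cs w" and
      uvw: "Poly_Mapping.keys u \<subseteq> W" "Poly_Mapping.keys v \<subseteq> W" "Poly_Mapping.keys w \<subseteq> W"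
      by (auto simp: T_carrier)
    moreover have "cs (tm (tm u v) w) = cs (tm u (tm v w))"
      by (intro cs_eqI tm_assoc tm_closed uvw)
    ultimately show "x \<otimes>\<^bsub>T\<^esub> y \<otimes>\<^bsub>T\<^esub> z = x \<otimes>\<^bsub>T\<^esub> (y \<otimes>\<^bsub>T\<^esub> z)"
      by (simp add: T_mult tm_closed uvw)
  next
    fix x y assume "x \<in> carrier T" "y \<in> carrier T"
    then obtain u v where "x = cs u" "y = cs v" and
      uv: "Poly_Mapping.keys u \<subseteq> W" "Poly_Mapping.keys v \<subseteq> W"
      by (auto simp: T_carrier)
    then show "x \<otimes>\<^bsub>T\<^esub> y \<in> carrier T"
      using tm_closed[OF uv] by (simp add: T_mult T_carrier)
  next
    show "\<one>\<^bsub>T\<^esub> \<in> carrier T"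
      using T1_keys unfolding T_one T_carrier by blast
  next
    fix x assume "x \<in> carrier T"
    then obtain u where x: "x = cs u" and u: "Poly_Mapping.keys u \<subseteq> W" by (auto simp: T_carrier)
    show "\<one>\<^bsub>T\<^esub> \<otimes>\<^bsub>T\<^esub> x = x" unfolding x T_one by (simp only: T_mult[OF T1_keys u] T1_left[OF u])
    show "x \<otimes>\<^bsub>T\<^esub> \<one>\<^bsub>T\<^esub> = x" unfolding x T_one by (simp only: T_mult[OF u T1_keys] T1_right[OF u])
  qed
qed (auto simp: T_carrier T_mult T_add tm_closed keysW_add tensor_mult_add_left tensor_mult_add_right)

end


section \<open>The two kinds of categories\<close>

definition mod_object ::
    "('k, 'kx) ring_scheme \<Rightarrow> ('k, 'a) module \<Rightarrow> ('a, 'm) rmodule \<Rightarrow> bool" where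
  "mod_object K \<Lambda> M \<longleftrightarrow> right_module \<Lambda> M \<and> vectorspace.fin_dim K (right_scalars \<Lambda> M)"

text \<open>The second clause is \<open>M\<cdot>I\<^sup>k = 0\<close> for some \<open>k\<close>.\<close>

definition acts_nilpotently :: "'a set \<Rightarrow> ('a, 'm, 'x) rmodule_scheme \<Rightarrow> bool" where
  "acts_nilpotently I M \<longleftrightarrow>
     (\<exists>k. \<forall>x\<in>carrier M. \<forall>rs. length rs = k \<and> set rs \<subseteq> I \<longrightarrow> foldl (ract M) x rs = \<zero>\<^bsub>M\<^esub>)"

definition nmod_object ::
    "('n::finite \<Rightarrow> ('k, 'f) module) \<Rightarrow> ('n \<Rightarrow> 'n \<Rightarrow> ('f, 'e) bimodule)
     \<Rightarrow> ((('n, 'f, 'e) tensor_word \<Rightarrow>\<^sub>0 int) set, 'm) rmodule \<Rightarrow> bool" where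
  "nmod_object F E M \<longleftrightarrow>
     right_module (tensor_algebra F E) M \<and> rmodule_fin_gen (tensor_algebra F E) M \<and>
     acts_nilpotently (tensor_radical F E) M"

text \<open>\<open>S\<close> lists the simple objects, up to isomorphism and without repetition.  HOL cannot quantify
  over modules on all carrier types; the type \<open>'a set\<close> suffices for completeness of the list,
  since a simple right \<open>A\<close>-module is isomorphic to a quotient of \<open>A\<close> by a right ideal, whose
  elements are subsets of \<open>A\<close>.\<close>

definition mod_simples ::
    "('k, 'kx) ring_scheme \<Rightarrow> ('k, 'a) module \<Rightarrow> ('n \<Rightarrow> ('a, 's) rmodule) \<Rightarrow> bool" where
  "mod_simples K \<Lambda> S \<longleftrightarrow>
     (\<forall>i. mod_object K \<Lambda> (S i) \<and> rmodule_simple \<Lambda> (S i)) \<and>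
     (\<forall>i j. rmodule_iso \<Lambda> (S i) (S j) \<longrightarrow> i = j) \<and>
     (\<forall>X :: ('a, 'a set) rmodule.
        mod_object K \<Lambda> X \<and> rmodule_simple \<Lambda> X \<longrightarrow> (\<exists>i. rmodule_iso \<Lambda> X (S i)))"

definition nmod_simples ::
    "('n::finite \<Rightarrow> ('k, 'f) module) \<Rightarrow> ('n \<Rightarrow> 'n \<Rightarrow> ('f, 'e) bimodule)
     \<Rightarrow> ('n \<Rightarrow> ((('n, 'f, 'e) tensor_word \<Rightarrow>\<^sub>0 int) set, 's) rmodule) \<Rightarrow> bool" where
  "nmod_simples F E S \<longleftrightarrow>
     (\<forall>i. nmod_object F E (S i) \<and> rmodule_simple (tensor_algebra F E) (S i)) \<and>
     (\<forall>i j. rmodule_iso (tensor_algebra F E) (S i) (S j) \<longrightarrow> i = j) \<and>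
     (\<forall>X :: ((('n, 'f, 'e) tensor_word \<Rightarrow>\<^sub>0 int) set,
              (('n, 'f, 'e) tensor_word \<Rightarrow>\<^sub>0 int) set set) rmodule.
        nmod_object F E X \<and> rmodule_simple (tensor_algebra F E) X
        \<longrightarrow> (\<exists>i. rmodule_iso (tensor_algebra F E) X (S i)))"


section \<open>Dimension vectors\<close>

definition composition_series ::
    "('a, 'r) ring_scheme \<Rightarrow> ('a, 'm) rmodule \<Rightarrow> 'm set list \<Rightarrow> bool" where
  "composition_series A M Ns \<longleftrightarrow>
     Ns \<noteq> [] \<and> hd Ns = {\<zero>\<^bsub>M\<^esub>} \<and> last Ns = carrier M \<and> (\<forall>N\<in>set Ns. rsubmodule A M N) \<and>
     (\<forall>r. Suc r < length Ns \<longrightarrow> Ns ! r \<subseteq> Ns ! Suc r \<and>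
        rmodule_simple A (quot_rmodule (M\<lparr>carrier := Ns ! Suc r\<rparr>) (Ns ! r)))"

definition series_multiplicity ::
    "('a, 'r) ring_scheme \<Rightarrow> ('a, 'm) rmodule \<Rightarrow> 'm set list \<Rightarrow> ('a, 's) rmodule \<Rightarrow> nat" where
  "series_multiplicity A M Ns X =
     card {r. Suc r < length Ns \<and>
              rmodule_iso A (quot_rmodule (M\<lparr>carrier := Ns ! Suc r\<rparr>) (Ns ! r)) X}"

text \<open>By the Jordan--Hoelder theorem the choice of the composition series is irrelevant.\<close>

definition dim_vector ::
    "('a, 'r) ring_scheme \<Rightarrow> ('n \<Rightarrow> ('a, 's) rmodule) \<Rightarrow> ('a, 'm) rmodule \<Rightarrow> int ^ 'n" where
  "dim_vector A S M =
     (\<chi> i. int (series_multiplicity A M (SOME Ns. composition_series A M Ns) (S i)))"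

definition real_vec :: "int ^ 'n \<Rightarrow> real ^ 'n" where
  "real_vec x = (\<chi> i. real_of_int (x $ i))"


section \<open>Stability\<close>

definition linear_stability :: "real ^ 'n \<Rightarrow> real ^ 'n \<Rightarrow> (int ^ 'n \<Rightarrow> complex) \<Rightarrow> bool" where
  "linear_stability a b Z \<longleftrightarrow>
     (\<forall>i. 0 < b $ i) \<and>
     (\<forall>x. Z x = complex_of_real (a \<bullet> real_vec x) + \<i> * complex_of_real (b \<bullet> real_vec x))"

definition slope ::
    "('a, 'r) ring_scheme \<Rightarrow> ('n \<Rightarrow> ('a, 's) rmodule) \<Rightarrow> (int ^ 'n \<Rightarrow> complex)
     \<Rightarrow> ('a, 'm) rmodule \<Rightarrow> real" where
  "slope A S Z M = Re (Z (dim_vector A S M)) / Im (Z (dim_vector A S M))"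

lemma slope_linear_stability:
  assumes "linear_stability a b Z"
  shows "slope A S Z M =
    (a \<bullet> real_vec (dim_vector A S M)) / (b \<bullet> real_vec (dim_vector A S M))"
  using assms by (simp add: slope_def linear_stability_def)

definition semistable ::
    "('a, 'r) ring_scheme \<Rightarrow> ('n \<Rightarrow> ('a, 's) rmodule) \<Rightarrow> (int ^ 'n \<Rightarrow> complex)
     \<Rightarrow> ('a, 'm) rmodule \<Rightarrow> bool" where
  "semistable A S Z M \<longleftrightarrow> carrier M \<noteq> {\<zero>\<^bsub>M\<^esub>} \<and>
     (\<forall>N. rsubmodule A M N \<and> N \<noteq> {\<zero>\<^bsub>M\<^esub>} \<and> N \<noteq> carrier M
        \<longrightarrow> slope A S Z (M\<lparr>carrier := N\<rparr>) \<ge> slope A S Z M)"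

definition stable ::
    "('a, 'r) ring_scheme \<Rightarrow> ('n \<Rightarrow> ('a, 's) rmodule) \<Rightarrow> (int ^ 'n \<Rightarrow> complex)
     \<Rightarrow> ('a, 'm) rmodule \<Rightarrow> bool" where
  "stable A S Z M \<longleftrightarrow> carrier M \<noteq> {\<zero>\<^bsub>M\<^esub>} \<and>
     (\<forall>N. rsubmodule A M N \<and> N \<noteq> {\<zero>\<^bsub>M\<^esub>} \<and> N \<noteq> carrier M
        \<longrightarrow> slope A S Z (M\<lparr>carrier := N\<rparr>) > slope A S Z M)"

definition dim_hyperplane ::
    "('a, 'r) ring_scheme \<Rightarrow> ('n \<Rightarrow> ('a, 's) rmodule) \<Rightarrow> ('a, 'm) rmodule \<Rightarrow> (real ^ 'n) set" where
  "dim_hyperplane A S M = {x. x \<bullet> real_vec (dim_vector A S M) = 0}"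

definition stab_domain ::
    "('a, 'r) ring_scheme \<Rightarrow> ('n \<Rightarrow> ('a, 's) rmodule) \<Rightarrow> ('a, 'm) rmodule \<Rightarrow> (real ^ 'n) set" where
  "stab_domain A S M =
     {x \<in> dim_hyperplane A S M. \<forall>N. rsubmodule A M N
        \<longrightarrow> x \<bullet> real_vec (dim_vector A S (M\<lparr>carrier := N\<rparr>)) \<le> 0}"

definition int_stab_domain ::
    "('a, 'r) ring_scheme \<Rightarrow> ('n \<Rightarrow> ('a, 's) rmodule) \<Rightarrow> ('a, 'm) rmodule \<Rightarrow> (real ^ 'n) set" where
  "int_stab_domain A S M =
     {x \<in> stab_domain A S M. \<forall>N. rsubmodule A M N \<and> N \<noteq> {\<zero>\<^bsub>M\<^esub>} \<and> N \<noteq> carrier M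
        \<longrightarrow> x \<bullet> real_vec (dim_vector A S (M\<lparr>carrier := N\<rparr>)) < 0}"

definition stability_path :: "real ^ 'n \<Rightarrow> real ^ 'n \<Rightarrow> real \<Rightarrow> real ^ 'n" where
  "stability_path a b t = t *\<^sub>R b - a"

end

theory Submission
  imports Defs
begin

text \<open>Pairing \<open>t b - a\<close> with the dimension vector of \<open>N\<close> gives
  \<open>(b \<bullet> dim N) (t - \<mu>(N))\<close>, so as soon as \<open>b \<bullet> dim N > 0\<close> for all nonzero submodules \<open>N \<subseteq> M\<close>,
  membership in the hyperplane of \<open>M\<close> forces \<open>t = \<mu>(M)\<close>, and the remaining inequalities compare
  slopes.  Dimension vectors of different modules are never related to each other, so neither
  additivity nor the Jordan--Hoelder theorem is needed; what has to be shown is that every nonzero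
  submodule has a composition series and that its first factor is one of the listed simple objects.
  The first point follows from \<open>M\<close> being finite dimensional over \<open>K\<close>.  In the case of a modulated
  quiver this holds because a generator is annihilated by long tensor words, while acting by an edge
  maps finite dimensional spaces into finite dimensional ones.  For the second point, a simple module
  is a quotient of the regular module, which lies in the category again.\<close>

section \<open>Submodules and quotient modules\<close>

text \<open>\<open>dim_vector\<close> counts factors in a series picked by Hilbert choice, and a
  slope is meaningful only if its denominator b \<bullet> dim N is positive. The two categories
  supply this positivity through two hypotheses of \<open>stability_path_criterion\<close>: a
  strictly monotone \<open>nat\<close>-valued function \<open>d\<close> on submodules, standing in
  for the dimension over \<open>K\<close>, and an entry of \<open>S\<close> for every simple
  subquotient of \<open>M\<close>. For the first, \<open>K\<close> acts through a ring homomorphism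
  into the acting ring, given by the multiples of 1 in an algebra and by \<open>diag\<close> in a
  tensor algebra. The obstacle in the second is the carrier type: a composition factor of
  \<open>M\<close> consists of sets of elements of \<open>M\<close>, whereas completeness of
  \<open>S\<close> is assumed only for modules whose elements are subsets of the ring. A factor is
  therefore replaced by a quotient of the regular module by a right ideal. That this model lies in
  the category has to be shown separately: by a linear surjection from the algebra in one case, by a
  generator and transport of nilpotency in the other.\<close>

context right_module
begin

lemma ract_zero_left: assumes "a \<in> carrier A" shows "\<zero>\<^bsub>M\<^esub> \<triangleleft>\<^bsub>M\<^esub> a = \<zero>\<^bsub>M\<^esub>"
proof -
  have "\<zero>\<^bsub>M\<^esub> \<triangleleft>\<^bsub>M\<^esub> a \<oplus>\<^bsub>M\<^esub> \<zero>\<^bsub>M\<^esub> \<triangleleft>\<^bsub>M\<^esub> a = \<zero>\<^bsub>M\<^esub> \<triangleleft>\<^bsub>M\<^esub> a"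
    using ract_add_left[of "\<zero>\<^bsub>M\<^esub>" "\<zero>\<^bsub>M\<^esub>" a] assms by simp
  then show ?thesis using ract_closed[of "\<zero>\<^bsub>M\<^esub>" a] assms M.add.r_cancel_one by simp
qed

lemma ract_zero_right: assumes "x \<in> carrier M" shows "x \<triangleleft>\<^bsub>M\<^esub> \<zero>\<^bsub>A\<^esub> = \<zero>\<^bsub>M\<^esub>"
proof -
  have "x \<triangleleft>\<^bsub>M\<^esub> \<zero>\<^bsub>A\<^esub> \<oplus>\<^bsub>M\<^esub> x \<triangleleft>\<^bsub>M\<^esub> \<zero>\<^bsub>A\<^esub> = x \<triangleleft>\<^bsub>M\<^esub> \<zero>\<^bsub>A\<^esub>"
    using ract_add_right[of x "\<zero>\<^bsub>A\<^esub>" "\<zero>\<^bsub>A\<^esub>"] assms by simp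
  then show ?thesis using ract_closed[of x "\<zero>\<^bsub>A\<^esub>"] assms M.add.r_cancel_one by simp
qed

lemma ract_minus_right: assumes "x \<in> carrier M" "a \<in> carrier A"
  shows "x \<triangleleft>\<^bsub>M\<^esub> (\<ominus>\<^bsub>A\<^esub> a) = \<ominus>\<^bsub>M\<^esub> (x \<triangleleft>\<^bsub>M\<^esub> a)"
proof -
  have "x \<triangleleft>\<^bsub>M\<^esub> (\<ominus>\<^bsub>A\<^esub> a) \<oplus>\<^bsub>M\<^esub> x \<triangleleft>\<^bsub>M\<^esub> a = \<zero>\<^bsub>M\<^esub>"
    using ract_add_right[of x "\<ominus>\<^bsub>A\<^esub> a" a] assms by (simp add: A.l_neg ract_zero_right)
  then show ?thesis using M.minus_equality assms by (simp add: ract_closed)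
qed

text \<open>In \<open>rsubmodule_iff\<close> this turns closure under the action into closure under
  additive inverses.\<close>

lemma minus_as_ract: assumes "x \<in> carrier M" shows "\<ominus>\<^bsub>M\<^esub> x = x \<triangleleft>\<^bsub>M\<^esub> (\<ominus>\<^bsub>A\<^esub> \<one>\<^bsub>A\<^esub>)"
  using ract_minus_right[of x "\<one>\<^bsub>A\<^esub>"] assms by (simp add: ract_one)

lemma rsubmodule_iff:
  "rsubmodule A M N \<longleftrightarrow> N \<subseteq> carrier M \<and> \<zero>\<^bsub>M\<^esub> \<in> N \<and>
     (\<forall>x\<in>N. \<forall>y\<in>N. x \<oplus>\<^bsub>M\<^esub> y \<in> N) \<and> (\<forall>x\<in>N. \<forall>a\<in>carrier A. x \<triangleleft>\<^bsub>M\<^esub> a \<in> N)"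
proof
  assume "rsubmodule A M N"
  then have "additive_subgroup N M" and r: "\<forall>x\<in>N. \<forall>a\<in>carrier A. x \<triangleleft>\<^bsub>M\<^esub> a \<in> N"
    by (auto simp: rsubmodule_def)
  then interpret additive_subgroup N M by simp
  show "N \<subseteq> carrier M \<and> \<zero>\<^bsub>M\<^esub> \<in> N \<and>
     (\<forall>x\<in>N. \<forall>y\<in>N. x \<oplus>\<^bsub>M\<^esub> y \<in> N) \<and> (\<forall>x\<in>N. \<forall>a\<in>carrier A. x \<triangleleft>\<^bsub>M\<^esub> a \<in> N)"
    using a_subset r by auto
next
  assume N: "N \<subseteq> carrier M \<and> \<zero>\<^bsub>M\<^esub> \<in> N \<and>
     (\<forall>x\<in>N. \<forall>y\<in>N. x \<oplus>\<^bsub>M\<^esub> y \<in> N) \<and> (\<forall>x\<in>N. \<forall>a\<in>carrier A. x \<triangleleft>\<^bsub>M\<^esub> a \<in> N)"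
  have "\<ominus>\<^bsub>M\<^esub> x \<in> N" if "x \<in> N" for x
    using N that minus_as_ract[of x] by auto
  then have "additive_subgroup N M"
    using N by (intro additive_subgroup.intro M.add.subgroupI) (auto simp: a_inv_def)
  then show "rsubmodule A M N" using N by (auto simp: rsubmodule_def)
qed

lemma rsubmodule_zero: "rsubmodule A M {\<zero>\<^bsub>M\<^esub>}"
  by (auto simp: rsubmodule_iff ract_zero_left)

lemma rsubmodule_carrier: "rsubmodule A M (carrier M)"
  by (auto simp: rsubmodule_iff ract_closed)

lemma right_module_rsubmodule:
  assumes "rsubmodule A M N" shows "right_module A (M\<lparr>carrier := N\<rparr>)"
proof -
  have N: "N \<subseteq> carrier M" "\<zero>\<^bsub>M\<^esub> \<in> N" "\<And>x y. x \<in> N \<Longrightarrow> y \<in> N \<Longrightarrow> x \<oplus>\<^bsub>M\<^esub> y \<in> N"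
     "\<And>x a. x \<in> N \<Longrightarrow> a \<in> carrier A \<Longrightarrow> x \<triangleleft>\<^bsub>M\<^esub> a \<in> N"
    using assms by (auto simp: rsubmodule_iff)
  have "abelian_group (M\<lparr>carrier := N\<rparr>)"
  proof (rule abelian_groupI)
    fix x assume x: "x \<in> carrier (M\<lparr>carrier := N\<rparr>)"
    then have "\<ominus>\<^bsub>M\<^esub> x \<in> N" using N minus_as_ract[of x] by auto
    then show "\<exists>y\<in>carrier (M\<lparr>carrier := N\<rparr>). y \<oplus>\<^bsub>M\<lparr>carrier := N\<rparr>\<^esub> x = \<zero>\<^bsub>M\<lparr>carrier := N\<rparr>\<^esub>"
      using x N(1) M.l_neg by (auto intro!: bexI[of _ "\<ominus>\<^bsub>M\<^esub> x"])
  qed (use N in \<open>auto intro: M.add.m_comm simp: subset_iff M.a_assoc\<close>)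
  then show ?thesis
    unfolding right_module_def right_module_axioms_def
    using N A.ring_axioms by (auto simp: subset_iff ract_add_left ract_add_right ract_assoc ract_one)
qed

lemma rsubmodule_restrict_iff:
  assumes "rsubmodule A M N"
  shows "rsubmodule A (M\<lparr>carrier := N\<rparr>) L \<longleftrightarrow> rsubmodule A M L \<and> L \<subseteq> N"
proof -
  have "rsubmodule A (M\<lparr>carrier := N\<rparr>) L \<longleftrightarrow> L \<subseteq> N \<and> \<zero>\<^bsub>M\<^esub> \<in> L \<and>
     (\<forall>x\<in>L. \<forall>y\<in>L. x \<oplus>\<^bsub>M\<^esub> y \<in> L) \<and> (\<forall>x\<in>L. \<forall>a\<in>carrier A. x \<triangleleft>\<^bsub>M\<^esub> a \<in> L)"
    using right_module.rsubmodule_iff[OF right_module_rsubmodule[OF assms], of L] by simp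
  then show ?thesis using assms unfolding rsubmodule_iff by blast
qed

lemma foldl_ract_closed:
  assumes "x \<in> carrier M" "set rs \<subseteq> carrier A" shows "foldl (ract M) x rs \<in> carrier M"
  using assms by (induction rs arbitrary: x) (auto simp: ract_closed)

lemma foldl_ract_zero:
  assumes "set rs \<subseteq> carrier A" shows "foldl (ract M) \<zero>\<^bsub>M\<^esub> rs = \<zero>\<^bsub>M\<^esub>"
  using assms by (induction rs) (auto simp: ract_zero_left)

text \<open>The module laws are equations, and inverses in the image are images of inverses, so a
  surjection compatible with the operations carries the whole structure to the record
  \<open>Q\<close>. For the coset map this reduces the laws of a quotient module to
  \<open>quot_add\<close> and \<open>quot_ract\<close>.\<close>

lemma right_module_hom_image:
  assumes h: "h ` carrier M = carrier Q" and z: "h \<zero>\<^bsub>M\<^esub> = \<zero>\<^bsub>Q\<^esub>"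
    and add: "\<And>x y. x \<in> carrier M \<Longrightarrow> y \<in> carrier M \<Longrightarrow> h (x \<oplus>\<^bsub>M\<^esub> y) = h x \<oplus>\<^bsub>Q\<^esub> h y"
    and act: "\<And>x a. x \<in> carrier M \<Longrightarrow> a \<in> carrier A \<Longrightarrow> h (x \<triangleleft>\<^bsub>M\<^esub> a) = h x \<triangleleft>\<^bsub>Q\<^esub> a"
  shows "right_module A Q"
proof -
  have surj: "\<exists>u. u \<in> carrier M \<and> x = h u" if "x \<in> carrier Q" for x using that h by blast
  have "abelian_group Q"
  proof (rule abelian_groupI)
    fix x assume "x \<in> carrier Q"
    then obtain u where u: "u \<in> carrier M" "x = h u" using h by blast
    then have "h (\<ominus>\<^bsub>M\<^esub> u) \<oplus>\<^bsub>Q\<^esub> x = \<zero>\<^bsub>Q\<^esub>"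
      using add[of "\<ominus>\<^bsub>M\<^esub> u" u] z M.l_neg[of u] by simp
    moreover have "h (\<ominus>\<^bsub>M\<^esub> u) \<in> carrier Q" using u h by blast
    ultimately show "\<exists>y\<in>carrier Q. y \<oplus>\<^bsub>Q\<^esub> x = \<zero>\<^bsub>Q\<^esub>" by blast
  next
    fix x y w assume "x \<in> carrier Q" "y \<in> carrier Q" "w \<in> carrier Q"
    then obtain u v t where "u \<in> carrier M" "x = h u" "v \<in> carrier M" "y = h v" "t \<in> carrier M" "w = h t"
      by (meson surj)
    then show "x \<oplus>\<^bsub>Q\<^esub> y \<oplus>\<^bsub>Q\<^esub> w = x \<oplus>\<^bsub>Q\<^esub> (y \<oplus>\<^bsub>Q\<^esub> w)"
      using M.a_assoc[of u v t] add[of "u \<oplus>\<^bsub>M\<^esub> v" t] add[of u v] add[of v t] add[of u "v \<oplus>\<^bsub>M\<^esub> t"] by simp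
  next
    fix x y assume "x \<in> carrier Q" "y \<in> carrier Q"
    then obtain u v where uv: "u \<in> carrier M" "x = h u" "v \<in> carrier M" "y = h v"
      by (meson surj)
    then show "x \<oplus>\<^bsub>Q\<^esub> y = y \<oplus>\<^bsub>Q\<^esub> x" using M.a_comm[of u v] add[of u v] add[of v u] by simp
    have "h (u \<oplus>\<^bsub>M\<^esub> v) \<in> carrier Q" using uv h by blast
    then show "x \<oplus>\<^bsub>Q\<^esub> y \<in> carrier Q" using uv add by simp
  next
    show "\<zero>\<^bsub>Q\<^esub> \<in> carrier Q" using h z by (metis M.zero_closed imageI)
  next
    fix x assume "x \<in> carrier Q"
    then obtain u where "u \<in> carrier M" "x = h u" using h by blast
    then show "\<zero>\<^bsub>Q\<^esub> \<oplus>\<^bsub>Q\<^esub> x = x" using add[of "\<zero>\<^bsub>M\<^esub>" u] z by simp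
  qed
  moreover have "right_module_axioms A Q"
  proof
    fix x a assume x: "x \<in> carrier Q" and a: "a \<in> carrier A"
    then obtain u where u: "u \<in> carrier M" "x = h u" using h by blast
    have "h (u \<triangleleft>\<^bsub>M\<^esub> a) \<in> carrier Q" using u a h ract_closed by blast
    then show "x \<triangleleft>\<^bsub>Q\<^esub> a \<in> carrier Q" using u a act by simp
    fix b assume b: "b \<in> carrier A"
    show "x \<triangleleft>\<^bsub>Q\<^esub> (a \<oplus>\<^bsub>A\<^esub> b) = x \<triangleleft>\<^bsub>Q\<^esub> a \<oplus>\<^bsub>Q\<^esub> x \<triangleleft>\<^bsub>Q\<^esub> b"
      using act[of u "a \<oplus>\<^bsub>A\<^esub> b"] act[of u a] act[of u b] add[of "u \<triangleleft>\<^bsub>M\<^esub> a" "u \<triangleleft>\<^bsub>M\<^esub> b"] u a b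
      by (simp add: ract_add_right ract_closed)
    show "x \<triangleleft>\<^bsub>Q\<^esub> (a \<otimes>\<^bsub>A\<^esub> b) = x \<triangleleft>\<^bsub>Q\<^esub> a \<triangleleft>\<^bsub>Q\<^esub> b"
      using act[of u "a \<otimes>\<^bsub>A\<^esub> b"] act[of u a] act[of "u \<triangleleft>\<^bsub>M\<^esub> a" b] u a b
      by (simp add: ract_assoc ract_closed)
  next
    fix x assume x: "x \<in> carrier Q"
    then obtain u where u: "u \<in> carrier M" "x = h u" using h by blast
    then show "x \<triangleleft>\<^bsub>Q\<^esub> \<one>\<^bsub>A\<^esub> = x" using act[of u "\<one>\<^bsub>A\<^esub>"] by (simp add: ract_one)
    fix y a assume y: "y \<in> carrier Q" and a: "a \<in> carrier A"
    then obtain v where v: "v \<in> carrier M" "y = h v" using h by blast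
    show "(x \<oplus>\<^bsub>Q\<^esub> y) \<triangleleft>\<^bsub>Q\<^esub> a = x \<triangleleft>\<^bsub>Q\<^esub> a \<oplus>\<^bsub>Q\<^esub> y \<triangleleft>\<^bsub>Q\<^esub> a"
      using act[of "u \<oplus>\<^bsub>M\<^esub> v" a] act[of u a] act[of v a] add[of u v] add[of "u \<triangleleft>\<^bsub>M\<^esub> a" "v \<triangleleft>\<^bsub>M\<^esub> a"] u v a
      by (simp add: ract_add_left ract_closed)
  qed
  ultimately show ?thesis
    using A.ring_axioms by (simp add: right_module_def)
qed

section \<open>The quotient by a submodule\<close>

context
  fixes N assumes N: "rsubmodule A M N"
begin

interpretation as: abelian_subgroup N M
  using N M.abelian_group_axioms by (intro abelian_subgroupI3) (auto simp: rsubmodule_def)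

lemma quot_carrier: "carrier (quot_rmodule M N) = (\<lambda>x. N +>\<^bsub>M\<^esub> x) ` carrier M"
  by (auto simp: quot_rmodule_def A_RCOSETS_def' )

lemma quot_zero: "\<zero>\<^bsub>quot_rmodule M N\<^esub> = N +>\<^bsub>M\<^esub> \<zero>\<^bsub>M\<^esub>"
  using N by (simp add: quot_rmodule_def rsubmodule_iff M.a_coset_add_zero)

lemma quot_add: assumes "x \<in> carrier M" "y \<in> carrier M"
  shows "N +>\<^bsub>M\<^esub> (x \<oplus>\<^bsub>M\<^esub> y) = (N +>\<^bsub>M\<^esub> x) \<oplus>\<^bsub>quot_rmodule M N\<^esub> (N +>\<^bsub>M\<^esub> y)"
  using as.a_rcos_sum[OF assms] by (simp add: quot_rmodule_def)

lemma mem_coset_iff: assumes "x \<in> carrier M" 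
  shows "y \<in> N +>\<^bsub>M\<^esub> x \<longleftrightarrow> y \<in> carrier M \<and> (\<exists>n\<in>N. y = n \<oplus>\<^bsub>M\<^esub> x)"
  using N assms by (auto simp: a_r_coset_def' rsubmodule_iff)

lemma coset_eq_iff: assumes "x \<in> carrier M" "y \<in> carrier M"
  shows "N +>\<^bsub>M\<^esub> x = N +>\<^bsub>M\<^esub> y \<longleftrightarrow> (\<exists>n\<in>N. x = n \<oplus>\<^bsub>M\<^esub> y)"
  using mem_coset_iff[OF assms(2), of x] as.a_rcos_self[OF assms(1)] as.a_repr_independence'[OF _ assms(2), of x] assms
  by auto

text \<open>The action on cosets is a union over all representatives. Two of them differ by an
  element \<open>n\<close> of \<open>N\<close>, and \<open>n\<close> acted on by \<open>a\<close>
  stays in \<open>N\<close>, so all members of the union are the same coset.\<close>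

lemma quot_ract: assumes "x \<in> carrier M" "a \<in> carrier A"
  shows "N +>\<^bsub>M\<^esub> (x \<triangleleft>\<^bsub>M\<^esub> a) = (N +>\<^bsub>M\<^esub> x) \<triangleleft>\<^bsub>quot_rmodule M N\<^esub> a"
proof -
  have "N +>\<^bsub>M\<^esub> (y \<triangleleft>\<^bsub>M\<^esub> a) = N +>\<^bsub>M\<^esub> (x \<triangleleft>\<^bsub>M\<^esub> a)" if y: "y \<in> N +>\<^bsub>M\<^esub> x" for y
  proof -
    obtain n where n: "n \<in> N" "y = n \<oplus>\<^bsub>M\<^esub> x" "y \<in> carrier M" using y assms mem_coset_iff by blast
    then have "n \<in> carrier M" "n \<triangleleft>\<^bsub>M\<^esub> a \<in> N" using N assms by (auto simp: rsubmodule_iff)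
    then show ?thesis using n assms by (subst coset_eq_iff) (auto simp: ract_closed ract_add_left)
  qed
  then have "(\<Union>y\<in>N +>\<^bsub>M\<^esub> x. N +>\<^bsub>M\<^esub> (y \<triangleleft>\<^bsub>M\<^esub> a)) = (\<Union>y\<in>N +>\<^bsub>M\<^esub> x. N +>\<^bsub>M\<^esub> (x \<triangleleft>\<^bsub>M\<^esub> a))"
    by blast
  also have "\<dots> = N +>\<^bsub>M\<^esub> (x \<triangleleft>\<^bsub>M\<^esub> a)" using as.a_rcos_self[OF assms(1)] by blast
  finally show ?thesis by (simp add: quot_rmodule_def)
qed

lemma right_module_quot: "right_module A (quot_rmodule M N)"
  by (rule right_module_hom_image[where h = "\<lambda>x. N +>\<^bsub>M\<^esub> x"])
    (auto simp: quot_carrier quot_zero quot_add quot_ract)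

lemma quot_foldl:
  assumes "x \<in> carrier M" "set rs \<subseteq> carrier A"
  shows "foldl (ract (quot_rmodule M N)) (N +>\<^bsub>M\<^esub> x) rs = N +>\<^bsub>M\<^esub> foldl (ract M) x rs"
  using assms by (induction rs arbitrary: x) (auto simp: ract_closed simp flip: quot_ract)

lemma coset_eq_zero_iff: assumes "x \<in> carrier M"
  shows "N +>\<^bsub>M\<^esub> x = \<zero>\<^bsub>quot_rmodule M N\<^esub> \<longleftrightarrow> x \<in> N"
  unfolding quot_zero using N assms by (subst coset_eq_iff) (auto simp: rsubmodule_iff subset_iff)

text \<open>Correspondence of submodules: the preimage \<open>L\<close> of \<open>P\<close> contains
  \<open>N\<close>, so maximality leaves only two values for it, and \<open>P\<close> is recovered
  as the image of \<open>L\<close>.\<close>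

lemma quot_simple:
  assumes proper: "N \<noteq> carrier M"
    and max: "\<And>L. rsubmodule A M L \<Longrightarrow> N \<subseteq> L \<Longrightarrow> L = N \<or> L = carrier M"
  shows "rmodule_simple A (quot_rmodule M N)"
proof -
  let ?Q = "quot_rmodule M N" and ?\<pi> = "\<lambda>x. N +>\<^bsub>M\<^esub> x"
  interpret Q: right_module A ?Q by (rule right_module_quot)
  have NM: "N \<subseteq> carrier M" using N by (simp add: rsubmodule_iff)
  obtain x where "x \<in> carrier M" "x \<notin> N" using proper NM by blast
  then have nz: "carrier ?Q \<noteq> {\<zero>\<^bsub>?Q\<^esub>}" using coset_eq_zero_iff[of x] by (auto simp: quot_carrier)
  have "P = {\<zero>\<^bsub>?Q\<^esub>} \<or> P = carrier ?Q" if P: "rsubmodule A ?Q P" for P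
  proof -
    define L where "L = {x \<in> carrier M. ?\<pi> x \<in> P}"
    have "rsubmodule A M L" using P unfolding rsubmodule_iff Q.rsubmodule_iff
      by (auto simp: L_def quot_add quot_ract ract_closed simp flip: quot_zero)
    moreover have "N \<subseteq> L"
    proof
      fix x assume "x \<in> N"
      then have "?\<pi> x = \<zero>\<^bsub>?Q\<^esub>" "x \<in> carrier M" using NM coset_eq_zero_iff[of x] by auto
      then show "x \<in> L" using P by (simp add: L_def Q.rsubmodule_iff)
    qed
    ultimately consider "L = N" | "L = carrier M" using max by blast
    moreover have PL: "P = ?\<pi> ` L" using P by (auto simp: Q.rsubmodule_iff quot_carrier L_def)
    ultimately show ?thesis
    proof cases
      case 1
      have "P = {\<zero>\<^bsub>?Q\<^esub>}" using PL P NM coset_eq_zero_iff unfolding 1 by (auto simp: Q.rsubmodule_iff)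
      then show ?thesis ..
    next
      case 2
      then show ?thesis using PL by (simp add: quot_carrier)
    qed
  qed
  with nz show ?thesis by (auto simp: rmodule_simple_def)
qed

end

end

section \<open>Isomorphisms and simple modules\<close>

lemma (in right_module) hom_zero:
  assumes "right_module A X" "h \<zero>\<^bsub>M\<^esub> \<in> carrier X"
    and "h (\<zero>\<^bsub>M\<^esub> \<oplus>\<^bsub>M\<^esub> \<zero>\<^bsub>M\<^esub>) = h \<zero>\<^bsub>M\<^esub> \<oplus>\<^bsub>X\<^esub> h \<zero>\<^bsub>M\<^esub>"
  shows "h \<zero>\<^bsub>M\<^esub> = \<zero>\<^bsub>X\<^esub>"
proof -
  interpret X: right_module A X by fact
  show ?thesis using assms(2,3) X.M.add.r_cancel_one[of "h \<zero>\<^bsub>M\<^esub>" "h \<zero>\<^bsub>M\<^esub>"] by simp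
qed

lemma rmodule_iso_trans:
  assumes "rmodule_iso A L M" "rmodule_iso A M N"
  shows "rmodule_iso A L N"
proof -
  obtain g where g: "bij_betw g (carrier L) (carrier M)"
    "\<forall>x\<in>carrier L. \<forall>y\<in>carrier L. g (x \<oplus>\<^bsub>L\<^esub> y) = g x \<oplus>\<^bsub>M\<^esub> g y"
    "\<forall>x\<in>carrier L. \<forall>a\<in>carrier A. g (x \<triangleleft>\<^bsub>L\<^esub> a) = g x \<triangleleft>\<^bsub>M\<^esub> a"
    using assms(1) by (auto simp: rmodule_iso_def)
  obtain h where h: "bij_betw h (carrier M) (carrier N)"
    "\<forall>x\<in>carrier M. \<forall>y\<in>carrier M. h (x \<oplus>\<^bsub>M\<^esub> y) = h x \<oplus>\<^bsub>N\<^esub> h y"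
    "\<forall>x\<in>carrier M. \<forall>a\<in>carrier A. h (x \<triangleleft>\<^bsub>M\<^esub> a) = h x \<triangleleft>\<^bsub>N\<^esub> a"
    using assms(2) by (auto simp: rmodule_iso_def)
  have "\<forall>x\<in>carrier L. g x \<in> carrier M" using g(1) by (auto simp: bij_betw_def)
  then show ?thesis
    unfolding rmodule_iso_def using g h bij_betw_trans[OF g(1) h(1)]
    by (intro exI[of _ "h \<circ> g"]) simp
qed

context right_module
begin

lemma rmodule_iso_sym:
  assumes "rmodule_iso A M N" shows "rmodule_iso A N M"
proof -
  obtain h where h: "bij_betw h (carrier M) (carrier N)"
    "\<And>x y. x \<in> carrier M \<Longrightarrow> y \<in> carrier M \<Longrightarrow> h (x \<oplus>\<^bsub>M\<^esub> y) = h x \<oplus>\<^bsub>N\<^esub> h y"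
    "\<And>x a. x \<in> carrier M \<Longrightarrow> a \<in> carrier A \<Longrightarrow> h (x \<triangleleft>\<^bsub>M\<^esub> a) = h x \<triangleleft>\<^bsub>N\<^esub> a"
    using assms by (auto simp: rmodule_iso_def)
  define g where "g = inv_into (carrier M) h"
  have gh: "g (h x) = x" if "x \<in> carrier M" for x
    using that h(1) by (simp add: g_def bij_betw_def)
  have surj: "\<exists>u. u \<in> carrier M \<and> x = h u" if "x \<in> carrier N" for x
    using that h(1) by (auto simp: bij_betw_def)
  show ?thesis unfolding rmodule_iso_def
  proof (intro exI[of _ g] conjI ballI)
    show "bij_betw g (carrier N) (carrier M)" unfolding g_def by (rule bij_betw_inv_into[OF h(1)])
  next
    fix x y assume "x \<in> carrier N" "y \<in> carrier N"
    then obtain u v where "u \<in> carrier M" "x = h u" "v \<in> carrier M" "y = h v"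
      by (meson surj)
    then show "g (x \<oplus>\<^bsub>N\<^esub> y) = g x \<oplus>\<^bsub>M\<^esub> g y" using h(2)[of u v] gh by (metis M.add.m_closed)
  next
    fix x a assume "x \<in> carrier N" and a: "a \<in> carrier A"
    then obtain u where "u \<in> carrier M" "x = h u" by (meson surj)
    then show "g (x \<triangleleft>\<^bsub>N\<^esub> a) = g x \<triangleleft>\<^bsub>M\<^esub> a" using h(3)[of u a] gh a by (metis ract_closed)
  qed
qed

lemma first_isomorphism:
  assumes X: "right_module A X" and surj: "h ` carrier M = carrier X"
    and add: "\<And>x y. x \<in> carrier M \<Longrightarrow> y \<in> carrier M \<Longrightarrow> h (x \<oplus>\<^bsub>M\<^esub> y) = h x \<oplus>\<^bsub>X\<^esub> h y"
    and act: "\<And>x a. x \<in> carrier M \<Longrightarrow> a \<in> carrier A \<Longrightarrow> h (x \<triangleleft>\<^bsub>M\<^esub> a) = h x \<triangleleft>\<^bsub>X\<^esub> a"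
  shows "rsubmodule A M {x \<in> carrier M. h x = \<zero>\<^bsub>X\<^esub>}"
    and "rmodule_iso A (quot_rmodule M {x \<in> carrier M. h x = \<zero>\<^bsub>X\<^esub>}) X"
proof -
  interpret X: right_module A X by fact
  define N where "N = {x \<in> carrier M. h x = \<zero>\<^bsub>X\<^esub>}"
  define \<pi> where "\<pi> x = N +>\<^bsub>M\<^esub> x" for x
  have hc: "h x \<in> carrier X" if "x \<in> carrier M" for x using surj that by blast
  have h0: "h \<zero>\<^bsub>M\<^esub> = \<zero>\<^bsub>X\<^esub>" by (rule hom_zero[OF X]) (simp_all only: hc M.zero_closed add)
  have N: "rsubmodule A M N"
    by (auto simp: N_def rsubmodule_iff h0 add act ract_closed X.ract_zero_left)
  \<comment> \<open>The induced map evaluates \<open>h\<close> at an arbitrary representative of the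
    coset. The choice does not matter because representatives differ by elements of
    \<open>N\<close>, on which \<open>h\<close> vanishes.\<close>
  define g where "g C = h (SOME y. y \<in> C)" for C
  have g: "g (\<pi> x) = h x" if x: "x \<in> carrier M" for x
  proof -
    have "x \<in> \<pi> x" using mem_coset_iff[OF N x, of x] x N unfolding \<pi>_def rsubmodule_iff by (metis M.l_zero)
    then have "(SOME y. y \<in> \<pi> x) \<in> \<pi> x" by (rule someI)
    then obtain n where "n \<in> N" "(SOME y. y \<in> \<pi> x) = n \<oplus>\<^bsub>M\<^esub> x" using mem_coset_iff[OF N x] unfolding \<pi>_def by blast
    then show ?thesis using x hc[OF x] by (simp add: g_def add N_def)
  qed
  have inj: "\<pi> x = \<pi> y" if "x \<in> carrier M" "y \<in> carrier M" "h x = h y" for x y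
  proof -
    have my: "\<ominus>\<^bsub>M\<^esub> y \<in> carrier M" using that by simp
    have "h (x \<oplus>\<^bsub>M\<^esub> \<ominus>\<^bsub>M\<^esub> y) = h (y \<oplus>\<^bsub>M\<^esub> \<ominus>\<^bsub>M\<^esub> y)"
      using add[OF that(1) my] add[OF that(2) my] that(3) by simp
    then have "x \<oplus>\<^bsub>M\<^esub> \<ominus>\<^bsub>M\<^esub> y \<in> N" using that h0 by (simp add: M.r_neg N_def)
    moreover have "x = (x \<oplus>\<^bsub>M\<^esub> \<ominus>\<^bsub>M\<^esub> y) \<oplus>\<^bsub>M\<^esub> y" using that by (simp add: M.a_assoc M.l_neg)
    ultimately show ?thesis using coset_eq_iff[OF N that(1,2)] unfolding \<pi>_def by blast
  qed
  have car: "carrier (quot_rmodule M N) = \<pi> ` carrier M" by (simp add: quot_carrier[OF N] \<pi>_def)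
  have "bij_betw g (carrier (quot_rmodule M N)) (carrier X)"
    unfolding bij_betw_def car
  proof
    show "inj_on g (\<pi> ` carrier M)"
    proof (rule inj_onI)
      fix C D assume "C \<in> \<pi> ` carrier M" "D \<in> \<pi> ` carrier M" and CD: "g C = g D"
      then obtain x y where xy: "x \<in> carrier M" "C = \<pi> x" "y \<in> carrier M" "D = \<pi> y" by blast
      then have "h x = h y" using CD g by metis
      then show "C = D" unfolding xy(2,4) by (rule inj[OF xy(1,3)])
    qed
    have "g ` \<pi> ` carrier M = h ` carrier M" using g by (simp add: image_image)
    then show "g ` \<pi> ` carrier M = carrier X" using surj by simp
  qed
  then have "rmodule_iso A (quot_rmodule M N) X"
    unfolding rmodule_iso_def
  proof (intro exI[of _ g] conjI ballI)
    fix C D assume "C \<in> carrier (quot_rmodule M N)" "D \<in> carrier (quot_rmodule M N)"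
    then obtain x y where "x \<in> carrier M" "C = \<pi> x" "y \<in> carrier M" "D = \<pi> y"
      unfolding car by blast
    then show "g (C \<oplus>\<^bsub>quot_rmodule M N\<^esub> D) = g C \<oplus>\<^bsub>X\<^esub> g D"
      using quot_add[OF N, of x y, folded \<pi>_def] g[of x] g[of y] g[of "x \<oplus>\<^bsub>M\<^esub> y"] add[of x y]
      by (metis M.add.m_closed)
  next
    fix C a assume "C \<in> carrier (quot_rmodule M N)" and a: "a \<in> carrier A"
    then obtain x where "x \<in> carrier M" "C = \<pi> x"
      unfolding car by blast
    then show "g (C \<triangleleft>\<^bsub>quot_rmodule M N\<^esub> a) = g C \<triangleleft>\<^bsub>X\<^esub> a"
      using quot_ract[OF N, of x a, folded \<pi>_def] g[of x] g[of "x \<triangleleft>\<^bsub>M\<^esub> a"] act[of x a] a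
      by (metis ract_closed)
  qed
  with N show "rsubmodule A M {x \<in> carrier M. h x = \<zero>\<^bsub>X\<^esub>}"
    and "rmodule_iso A (quot_rmodule M {x \<in> carrier M. h x = \<zero>\<^bsub>X\<^esub>}) X"
    unfolding N_def by simp_all
qed

text \<open>Simplicity is pulled back from the target of the isomorphism. In
  \<open>simple_cyclic\<close> the source is the quotient of the regular module and the target is
  the given simple module.\<close>

lemma rmodule_simple_iso:
  assumes X: "right_module A X" and iso: "rmodule_iso A M X" and simple: "rmodule_simple A X"
  shows "rmodule_simple A M"
proof -
  interpret X: right_module A X by fact
  obtain h where h: "bij_betw h (carrier M) (carrier X)"
    "\<And>x y. x \<in> carrier M \<Longrightarrow> y \<in> carrier M \<Longrightarrow> h (x \<oplus>\<^bsub>M\<^esub> y) = h x \<oplus>\<^bsub>X\<^esub> h y"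
    "\<And>x a. x \<in> carrier M \<Longrightarrow> a \<in> carrier A \<Longrightarrow> h (x \<triangleleft>\<^bsub>M\<^esub> a) = h x \<triangleleft>\<^bsub>X\<^esub> a"
    using iso by (auto simp: rmodule_iso_def)
  have hc: "h x \<in> carrier X" if "x \<in> carrier M" for x using h(1) that by (auto simp: bij_betw_def)
  have h0: "h \<zero>\<^bsub>M\<^esub> = \<zero>\<^bsub>X\<^esub>" by (rule hom_zero[OF X]) (simp_all only: hc M.zero_closed h)
  have image: "h ` carrier M = carrier X" "inj_on h (carrier M)" using h(1) by (auto simp: bij_betw_def)
  have "N = {\<zero>\<^bsub>M\<^esub>} \<or> N = carrier M" if N: "rsubmodule A M N" for N
  proof -
    have NM: "N \<subseteq> carrier M" using N by (simp add: rsubmodule_iff)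
    have "rsubmodule A X (h ` N)"
      unfolding X.rsubmodule_iff
    proof (intro conjI ballI)
      show "h ` N \<subseteq> carrier X" using NM hc by blast
      show "\<zero>\<^bsub>X\<^esub> \<in> h ` N" using N h0 by (metis image_eqI rsubmodule_iff)
    next
      fix x y assume "x \<in> h ` N" "y \<in> h ` N"
      then obtain u v where uv: "u \<in> N" "x = h u" "v \<in> N" "y = h v" by blast
      then have "u \<oplus>\<^bsub>M\<^esub> v \<in> N" "h (u \<oplus>\<^bsub>M\<^esub> v) = x \<oplus>\<^bsub>X\<^esub> y" using N NM h(2)[of u v] by (auto simp: rsubmodule_iff)
      then show "x \<oplus>\<^bsub>X\<^esub> y \<in> h ` N" by (metis imageI)
    next
      fix x a assume "x \<in> h ` N" and a: "a \<in> carrier A"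
      then obtain u where uv: "u \<in> N" "x = h u" by blast
      then have "u \<triangleleft>\<^bsub>M\<^esub> a \<in> N" "h (u \<triangleleft>\<^bsub>M\<^esub> a) = x \<triangleleft>\<^bsub>X\<^esub> a" using N NM a h(3)[of u a] by (auto simp: rsubmodule_iff)
      then show "x \<triangleleft>\<^bsub>X\<^esub> a \<in> h ` N" by (metis imageI)
    qed
    \<comment> \<open>Both alternatives are written as images, so that injectivity of
      \<open>h\<close> on the carrier cancels it.\<close>
    then consider "h ` N = h ` {\<zero>\<^bsub>M\<^esub>}" | "h ` N = h ` carrier M"
      using simple h0 image by (auto simp: rmodule_simple_def)
    then show ?thesis
    proof cases
      case 1
      then show ?thesis using inj_on_image_eq_iff[OF image(2) NM, of "{\<zero>\<^bsub>M\<^esub>}"] by simp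
    next
      case 2
      then show ?thesis using inj_on_image_eq_iff[OF image(2) NM, of "carrier M"] by simp
    qed
  qed
  moreover have "carrier M \<noteq> {\<zero>\<^bsub>M\<^esub>}"
  proof
    assume *: "carrier M = {\<zero>\<^bsub>M\<^esub>}"
    have "carrier X = {\<zero>\<^bsub>X\<^esub>}" using image(1) h0 unfolding * by simp
    then show False using simple by (simp add: rmodule_simple_def)
  qed
  ultimately show ?thesis by (auto simp: rmodule_simple_def)
qed

end

section \<open>Simple modules as quotients of the regular module\<close>

definition regular_rmodule :: "('a, 'r) ring_scheme \<Rightarrow> ('a, 'a) rmodule" where
  "regular_rmodule A = \<lparr>carrier = carrier A, monoid.mult = monoid.mult A, monoid.one = monoid.one A,
     ring.zero = ring.zero A, ring.add = ring.add A, ract = monoid.mult A\<rparr>"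

lemma regular_rmodule_simps [simp]:
  "carrier (regular_rmodule A) = carrier A" "\<zero>\<^bsub>regular_rmodule A\<^esub> = \<zero>\<^bsub>A\<^esub>"
  "x \<oplus>\<^bsub>regular_rmodule A\<^esub> y = x \<oplus>\<^bsub>A\<^esub> y" "x \<triangleleft>\<^bsub>regular_rmodule A\<^esub> a = x \<otimes>\<^bsub>A\<^esub> a"
  by (simp_all add: regular_rmodule_def)

lemma (in ring) right_module_regular: "right_module R (regular_rmodule R)"
proof -
  have "abelian_group (regular_rmodule R)"
  proof (rule abelian_groupI)
    fix x assume "x \<in> carrier (regular_rmodule R)"
    then show "\<exists>y\<in>carrier (regular_rmodule R). y \<oplus>\<^bsub>regular_rmodule R\<^esub> x = \<zero>\<^bsub>regular_rmodule R\<^esub>"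
      using l_neg by (intro bexI[of _ "\<ominus> x"]) simp_all
  qed (auto simp: a_assoc intro: add.m_comm)
  then show ?thesis
    unfolding right_module_def right_module_axioms_def using ring_axioms
    by (auto simp: l_distr r_distr m_assoc)
qed

text \<open>The multiples of a nonzero \<open>x\<close> form a nonzero submodule, hence all of
  \<open>M\<close>. Thus acting on \<open>x\<close> maps the ring onto \<open>M\<close>, and
  \<open>I\<close> is the annihilator of \<open>x\<close>.\<close>

lemma (in right_module) simple_cyclic:
  assumes simple: "rmodule_simple A M"
  obtains I where "rsubmodule A (regular_rmodule A) I"
    "rmodule_iso A (quot_rmodule (regular_rmodule A) I) M"
    "rmodule_simple A (quot_rmodule (regular_rmodule A) I)"
proof -
  interpret R: right_module A "regular_rmodule A" by (rule A.right_module_regular)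
  obtain x where x: "x \<in> carrier M" "x \<noteq> \<zero>\<^bsub>M\<^esub>"
    using simple M.zero_closed by (auto simp: rmodule_simple_def)
  let ?h = "\<lambda>a. x \<triangleleft>\<^bsub>M\<^esub> a"
  have "rsubmodule A M (?h ` carrier A)"
    unfolding rsubmodule_iff
  proof (intro conjI ballI)
    show "?h ` carrier A \<subseteq> carrier M" using x ract_closed by blast
    show "\<zero>\<^bsub>M\<^esub> \<in> ?h ` carrier A" using x ract_zero_right by (metis A.zero_closed imageI)
  next
    fix y z assume "y \<in> ?h ` carrier A" "z \<in> ?h ` carrier A"
    then obtain a b where "a \<in> carrier A" "y = ?h a" "b \<in> carrier A" "z = ?h b" by blast
    then show "y \<oplus>\<^bsub>M\<^esub> z \<in> ?h ` carrier A"
      using ract_add_right[of x a b] x by (metis A.add.m_closed imageI)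
  next
    fix y b assume "y \<in> ?h ` carrier A" and b: "b \<in> carrier A"
    then obtain a where "a \<in> carrier A" "y = ?h a" by blast
    then show "y \<triangleleft>\<^bsub>M\<^esub> b \<in> ?h ` carrier A"
      using ract_assoc[of x a b] x b by (metis A.m_closed imageI)
  qed
  moreover have "x \<in> ?h ` carrier A" using ract_one[OF x(1)] by (metis A.one_closed imageI)
  ultimately have surj: "?h ` carrier (regular_rmodule A) = carrier M"
    using simple x by (auto simp: rmodule_simple_def)
  note I = R.first_isomorphism[OF right_module_axioms surj]
  let ?I = "{a \<in> carrier (regular_rmodule A). ?h a = \<zero>\<^bsub>M\<^esub>}"
  have I: "rsubmodule A (regular_rmodule A) ?I" "rmodule_iso A (quot_rmodule (regular_rmodule A) ?I) M"
    by (rule I; use x in \<open>simp add: ract_add_right ract_assoc\<close>)+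
  interpret Q: right_module A "quot_rmodule (regular_rmodule A) ?I"
    by (rule R.right_module_quot[OF I(1)])
  show ?thesis
    using that[OF I Q.rmodule_simple_iso[OF right_module_axioms I(2) simple]] .
qed


section \<open>Composition series\<close>

text \<open>Among the proper submodules of \<open>N\<close>, one with the largest value of
  \<open>d\<close> is maximal, since a submodule strictly in between would have a larger value. Such
  a \<open>P\<close> exists because \<open>d N\<close> bounds these values; a series of
  \<open>P\<close> followed by \<open>N\<close> is a series of \<open>N\<close>.\<close>

lemma composition_series_exists:
  fixes M :: "('a, 'm) rmodule" and d :: "'m set \<Rightarrow> nat"
  assumes M: "right_module A M"
    and d: "\<And>P Q. rsubmodule A M P \<Longrightarrow> rsubmodule A M Q \<Longrightarrow> P \<subset> Q \<Longrightarrow> d P < d Q"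
    and "rsubmodule A M N"
  shows "\<exists>Ns. composition_series A (M\<lparr>carrier := N\<rparr>) Ns"
proof -
  interpret right_module A M by (rule M)
  from assms(3) show ?thesis
  proof (induction "d N" arbitrary: N rule: less_induct)
    case less
    note N = less.prems
    show ?case
    proof (cases "N = {\<zero>\<^bsub>M\<^esub>}")
      case True
      have "composition_series A (M\<lparr>carrier := N\<rparr>) [{\<zero>\<^bsub>M\<^esub>}]"
        using True rsubmodule_restrict_iff[OF N, of N] N by (simp add: composition_series_def)
      then show ?thesis by blast
    next
      case False
      let ?P = "\<lambda>P. rsubmodule A M P \<and> P \<subset> N"
      have "?P {\<zero>\<^bsub>M\<^esub>}" using False N rsubmodule_zero by (auto simp: rsubmodule_iff)
      moreover have "\<forall>P. ?P P \<longrightarrow> d P < d N" using d N by blast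
      ultimately have "\<exists>P. ?P P \<and> (\<forall>Q. ?P Q \<longrightarrow> d Q \<le> d P)"
        by (rule ex_has_greatest_nat)
      then obtain P where P: "rsubmodule A M P" "P \<subset> N" and max: "\<And>Q. ?P Q \<Longrightarrow> d Q \<le> d P"
        by auto
      obtain Ns where Ns: "composition_series A (M\<lparr>carrier := P\<rparr>) Ns"
        using less.hyps[OF d[OF P(1) N P(2)] P(1)] by blast
      interpret N: right_module A "M\<lparr>carrier := N\<rparr>" by (rule right_module_rsubmodule[OF N])
      have simple: "rmodule_simple A (quot_rmodule (M\<lparr>carrier := N\<rparr>) P)"
      proof (rule N.quot_simple)
        show "rsubmodule A (M\<lparr>carrier := N\<rparr>) P" using P rsubmodule_restrict_iff[OF N] by blast
        show "P \<noteq> carrier (M\<lparr>carrier := N\<rparr>)" using P by simp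
        fix L assume L: "rsubmodule A (M\<lparr>carrier := N\<rparr>) L" "P \<subseteq> L"
        then have L': "rsubmodule A M L" "L \<subseteq> N" using rsubmodule_restrict_iff[OF N] by auto
        show "L = P \<or> L = carrier (M\<lparr>carrier := N\<rparr>)"
        proof (rule ccontr)
          assume "\<not> ?thesis"
          then have "P \<subset> L" "L \<subset> N" using L L' by auto
          then show False using d[OF P(1) L'(1)] max[of L] L' by force
        qed
      qed
      have "composition_series A (M\<lparr>carrier := N\<rparr>) (Ns @ [N])"
        unfolding composition_series_def
      proof (intro conjI allI impI ballI)
        show "hd (Ns @ [N]) = {\<zero>\<^bsub>M\<lparr>carrier := N\<rparr>\<^esub>}" using Ns by (simp add: composition_series_def)
      next
        fix L assume "L \<in> set (Ns @ [N])"
        then consider "rsubmodule A (M\<lparr>carrier := P\<rparr>) L" | "L = N"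
          using Ns by (auto simp: composition_series_def)
        then show "rsubmodule A (M\<lparr>carrier := N\<rparr>) L"
          using P N by cases (auto simp: rsubmodule_restrict_iff)
      next
        fix r assume r: "Suc r < length (Ns @ [N])"
        \<comment> \<open>The last index gives the one new step, from \<open>P\<close> to
          \<open>N\<close>; all smaller indices belong to the series of \<open>P\<close>.\<close>
        have last: "Ns ! r = P" if "Suc r = length Ns"
        proof -
          have "Ns \<noteq> []" "last Ns = P" using Ns by (auto simp: composition_series_def)
          then show ?thesis using last_conv_nth[of Ns] that[symmetric] by simp
        qed
        show "(Ns @ [N]) ! r \<subseteq> (Ns @ [N]) ! Suc r"
          using Ns P r last by (cases "Suc r = length Ns") (auto simp: nth_append composition_series_def)
        show "rmodule_simple A (quot_rmodule (M\<lparr>carrier := N, carrier := (Ns @ [N]) ! Suc r\<rparr>) ((Ns @ [N]) ! r))"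
          using Ns simple r last by (cases "Suc r = length Ns") (auto simp: nth_append composition_series_def)
      qed simp_all
      then show ?thesis by blast
    qed
  qed
qed

section \<open>Dimension vectors and stability\<close>

lemma quot_rmodule_trivial:
  assumes "right_module A M" "carrier M = {\<zero>\<^bsub>M\<^esub>}"
  shows "\<not> rmodule_simple A (quot_rmodule M {\<zero>\<^bsub>M\<^esub>})"
proof -
  interpret right_module A M by fact
  show ?thesis
    using quot_carrier[OF rsubmodule_zero] quot_zero[OF rsubmodule_zero] assms(2)
    by (simp add: rmodule_simple_def)
qed

text \<open>The series behind \<open>dim_vector\<close> is an arbitrary choice, so every series of
  the zero module has to be considered. All its entries are zero, and a step would have a zero
  quotient, which is not simple; hence there is no step to count.\<close>

lemma dim_vector_zero:
  assumes "right_module A M" "carrier M = {\<zero>\<^bsub>M\<^esub>}"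
  shows "dim_vector A S M = 0"
proof -
  interpret right_module A M by fact
  have "composition_series A M [{\<zero>\<^bsub>M\<^esub>}]"
    using rsubmodule_zero assms(2) by (simp add: composition_series_def)
  define Ns where "Ns = (SOME Ns. composition_series A M Ns)"
  have Ns: "composition_series A M Ns" unfolding Ns_def by (rule someI) fact
  have "\<not> Suc r < length Ns" for r
  proof
    assume r: "Suc r < length Ns"
    have trivial: "N = {\<zero>\<^bsub>M\<^esub>}" if "N \<in> set Ns" for N
    proof -
      have "rsubmodule A M N" using that Ns by (simp add: composition_series_def)
      then have "N \<subseteq> {\<zero>\<^bsub>M\<^esub>}" "\<zero>\<^bsub>M\<^esub> \<in> N" using assms(2) by (simp_all add: rsubmodule_iff)
      then show ?thesis by blast
    qed
    have "Ns ! r = {\<zero>\<^bsub>M\<^esub>}" "Ns ! Suc r = {\<zero>\<^bsub>M\<^esub>}" using r by (auto intro!: trivial)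
    moreover have "rmodule_simple A (quot_rmodule (M\<lparr>carrier := Ns ! Suc r\<rparr>) (Ns ! r))"
      using Ns r by (simp add: composition_series_def)
    moreover have "M\<lparr>carrier := {\<zero>\<^bsub>M\<^esub>}\<rparr> = M" using assms(2) by simp
    ultimately show False using quot_rmodule_trivial[OF assms] by simp
  qed
  then show ?thesis by (simp add: dim_vector_def series_multiplicity_def vec_eq_iff flip: Ns_def)
qed

lemma dim_vector_nonneg: "0 \<le> dim_vector A S M $ i"
  by (simp add: dim_vector_def)

lemma dim_vector_pos:
  assumes "composition_series A M Ns" "carrier M \<noteq> {\<zero>\<^bsub>M\<^esub>}"
    and simples: "\<And>N L. rsubmodule A M N \<Longrightarrow> rsubmodule A M L \<Longrightarrow> L \<subseteq> N \<Longrightarrow>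
      rmodule_simple A (quot_rmodule (M\<lparr>carrier := N\<rparr>) L) \<Longrightarrow>
      \<exists>i. rmodule_iso A (quot_rmodule (M\<lparr>carrier := N\<rparr>) L) (S i)"
  shows "\<exists>i. 0 < dim_vector A S M $ i"
proof -
  \<comment> \<open>This name now shadows the series of the hypothesis, which only witnesses that
    the choice in \<open>dim_vector\<close> succeeds. The factors that count are those of the chosen
    series.\<close>
  define Ns where "Ns = (SOME Ns. composition_series A M Ns)"
  have Ns: "composition_series A M Ns" unfolding Ns_def using assms(1) by (rule someI)
  have len: "Suc 0 < length Ns"
  proof (rule ccontr)
    assume "\<not> ?thesis"
    then obtain N where "Ns = [N]" using Ns by (cases Ns) (auto simp: composition_series_def)
    then show False using Ns assms(2) by (auto simp: composition_series_def)
  qed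
  then obtain i where "rmodule_iso A (quot_rmodule (M\<lparr>carrier := Ns ! Suc 0\<rparr>) (Ns ! 0)) (S i)"
    using Ns simples[of "Ns ! Suc 0" "Ns ! 0"] by (auto simp: composition_series_def)
  then have "0 \<in> {r. Suc r < length Ns \<and>
      rmodule_iso A (quot_rmodule (M\<lparr>carrier := Ns ! Suc r\<rparr>) (Ns ! r)) (S i)}"
    using len by simp
  moreover have "finite {r. Suc r < length Ns \<and>
      rmodule_iso A (quot_rmodule (M\<lparr>carrier := Ns ! Suc r\<rparr>) (Ns ! r)) (S i)}"
    by (rule finite_subset[of _ "{..<length Ns}"]) auto
  ultimately have "0 < series_multiplicity A M Ns (S i)"
    unfolding series_multiplicity_def by (subst card_gt_0_iff) blast
  then show ?thesis by (auto simp: dim_vector_def simp flip: Ns_def)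
qed

lemma inner_real_vec_pos:
  fixes b :: "real ^ 'n::finite"
  assumes "\<And>i. 0 < b $ i" "\<And>i. 0 \<le> x $ i" "0 < x $ j"
  shows "0 < b \<bullet> real_vec x"
proof -
  have "0 < b $ j * real_of_int (x $ j)" using assms by simp
  also have "\<dots> \<le> (\<Sum>i\<in>UNIV. b $ i * real_of_int (x $ i))"
    by (rule member_le_sum) (use assms in \<open>auto simp: less_imp_le\<close>)
  finally show ?thesis by (simp add: inner_vec_def real_vec_def)
qed

proposition stability_path_criterion:
  fixes M :: "('a, 'm) rmodule" and d :: "'m set \<Rightarrow> nat" and a b :: "real ^ 'n::finite"
  assumes M: "right_module A M" and nonzero: "carrier M \<noteq> {\<zero>\<^bsub>M\<^esub>}"
    and d: "\<And>P Q. rsubmodule A M P \<Longrightarrow> rsubmodule A M Q \<Longrightarrow> P \<subset> Q \<Longrightarrow> d P < d Q"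
    and simples: "\<And>N L. rsubmodule A M N \<Longrightarrow> rsubmodule A M L \<Longrightarrow> L \<subseteq> N \<Longrightarrow>
      rmodule_simple A (quot_rmodule (M\<lparr>carrier := N\<rparr>) L) \<Longrightarrow>
      \<exists>i. rmodule_iso A (quot_rmodule (M\<lparr>carrier := N\<rparr>) L) (S i)"
    and Z: "linear_stability a b Z"
  shows "semistable A S Z M \<longleftrightarrow> (\<exists>t. stability_path a b t \<in> stab_domain A S M)"
    and "stable A S Z M \<longleftrightarrow> (\<exists>t. stability_path a b t \<in> int_stab_domain A S M)"
    and "\<forall>t. stability_path a b t \<in> stab_domain A S M \<longrightarrow> t = slope A S Z M"
    and "\<forall>t. stability_path a b t \<in> int_stab_domain A S M \<longrightarrow> t = slope A S Z M"
proof -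
  interpret right_module A M by (rule M)
  define \<delta> where "\<delta> N = real_vec (dim_vector A S (M\<lparr>carrier := N\<rparr>))" for N
  define \<mu> where "\<mu> N = slope A S Z (M\<lparr>carrier := N\<rparr>)" for N
  have \<mu>: "\<mu> N = (a \<bullet> \<delta> N) / (b \<bullet> \<delta> N)" for N
    unfolding \<mu>_def \<delta>_def by (rule slope_linear_stability[OF Z])
  \<comment> \<open>Updating the carrier of \<open>M\<close> by itself gives \<open>M\<close> back,
    so \<open>M\<close> is handled as one of its own submodules.\<close>
  have \<delta>M: "real_vec (dim_vector A S M) = \<delta> (carrier M)" and \<mu>M: "slope A S Z M = \<mu> (carrier M)"
    by (simp_all add: \<delta>_def \<mu>_def)
  have pos: "0 < b \<bullet> \<delta> N" if N: "rsubmodule A M N" and nz: "N \<noteq> {\<zero>\<^bsub>M\<^esub>}" for N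
  proof -
    have "\<exists>Ns. composition_series A (M\<lparr>carrier := N\<rparr>) Ns"
      by (rule composition_series_exists[OF M _ N]) (rule d)
    then obtain Ns where "composition_series A (M\<lparr>carrier := N\<rparr>) Ns" ..
    then have "\<exists>i. 0 < dim_vector A S (M\<lparr>carrier := N\<rparr>) $ i"
      by (rule dim_vector_pos) (use nz simples rsubmodule_restrict_iff[OF N] in auto)
    then obtain i where i: "0 < dim_vector A S (M\<lparr>carrier := N\<rparr>) $ i" ..
    show ?thesis unfolding \<delta>_def
      by (rule inner_real_vec_pos[OF _ dim_vector_nonneg i]) (use Z in \<open>simp add: linear_stability_def\<close>)
  qed
  have zero: "\<delta> {\<zero>\<^bsub>M\<^esub>} = 0"
    using dim_vector_zero[OF right_module_rsubmodule[OF rsubmodule_zero], of S]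
    by (simp add: \<delta>_def real_vec_def vec_eq_iff)
  have path: "stability_path a b t \<bullet> \<delta> N = (b \<bullet> \<delta> N) * (t - \<mu> N)"
    if "rsubmodule A M N" "N \<noteq> {\<zero>\<^bsub>M\<^esub>}" for N t
    using pos[OF that] by (simp add: stability_path_def \<mu> inner_diff_left field_simps)
  have hyperplane: "stability_path a b t \<in> dim_hyperplane A S M \<longleftrightarrow> t = \<mu> (carrier M)" for t
    using path[OF rsubmodule_carrier nonzero] pos[OF rsubmodule_carrier nonzero]
    by (simp add: dim_hyperplane_def \<delta>M)
  let ?proper = "\<lambda>N. rsubmodule A M N \<and> N \<noteq> {\<zero>\<^bsub>M\<^esub>} \<and> N \<noteq> carrier M"
  have le: "stability_path a b t \<bullet> \<delta> N \<le> 0 \<longleftrightarrow> t \<le> \<mu> N"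
    and less: "stability_path a b t \<bullet> \<delta> N < 0 \<longleftrightarrow> t < \<mu> N" if "?proper N" for t N
    using path[of N t] pos[of N] that by (auto simp: mult_le_0_iff mult_less_0_iff)
  have D: "stability_path a b t \<in> stab_domain A S M \<longleftrightarrow>
      t = \<mu> (carrier M) \<and> (\<forall>N. ?proper N \<longrightarrow> \<mu> (carrier M) \<le> \<mu> N)" for t
  proof -
    have "stability_path a b t \<in> stab_domain A S M \<longleftrightarrow> t = \<mu> (carrier M) \<and>
        (\<forall>N. rsubmodule A M N \<longrightarrow> stability_path a b t \<bullet> \<delta> N \<le> 0)"
      using hyperplane by (simp add: stab_domain_def \<delta>_def)
    \<comment> \<open>\<open>stab_domain\<close> also tests the zero submodule and \<open>M\<close>.
      The former has dimension vector 0, and for the latter the pairing vanishes once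
      \<open>t\<close> is the slope of \<open>M\<close>. What remains are the proper nonzero
      submodules, on which semistability is tested.\<close>
    moreover have "(\<forall>N. rsubmodule A M N \<longrightarrow> stability_path a b t \<bullet> \<delta> N \<le> 0) \<longleftrightarrow>
        (\<forall>N. ?proper N \<longrightarrow> t \<le> \<mu> N)" if "t = \<mu> (carrier M)"
      using le zero path[OF rsubmodule_carrier nonzero, of t] that
      by (metis inner_zero_right order_refl mult_zero_right diff_self)
    ultimately show ?thesis by auto
  qed
  have intD: "stability_path a b t \<in> int_stab_domain A S M \<longleftrightarrow>
      t = \<mu> (carrier M) \<and> (\<forall>N. ?proper N \<longrightarrow> \<mu> (carrier M) < \<mu> N)" for t
  proof -
    have "stability_path a b t \<in> int_stab_domain A S M \<longleftrightarrow> stability_path a b t \<in> stab_domain A S M \<and>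
        (\<forall>N. ?proper N \<longrightarrow> stability_path a b t \<bullet> \<delta> N < 0)"
      by (simp add: int_stab_domain_def \<delta>_def)
    \<comment> \<open>The strict inequalities contain the weak ones required by
      \<open>D\<close>.\<close>
    then show ?thesis using less unfolding D by (meson less_imp_le)
  qed
  show "semistable A S Z M \<longleftrightarrow> (\<exists>t. stability_path a b t \<in> stab_domain A S M)"
    unfolding D \<mu>M semistable_def \<mu>_def[symmetric] using nonzero by simp
  show "stable A S Z M \<longleftrightarrow> (\<exists>t. stability_path a b t \<in> int_stab_domain A S M)"
    unfolding intD \<mu>M stable_def \<mu>_def[symmetric] using nonzero by simp
  show "\<forall>t. stability_path a b t \<in> stab_domain A S M \<longrightarrow> t = slope A S Z M"
    unfolding D \<mu>M by simp
  show "\<forall>t. stability_path a b t \<in> int_stab_domain A S M \<longrightarrow> t = slope A S Z M"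
    unfolding intD \<mu>M by simp
qed

section \<open>Restriction of scalars to a field\<close>

text \<open>\<open>d P\<close> is the largest size of a linearly independent subset of
  \<open>P\<close>, that is, its dimension, expressed entirely inside \<open>V\<close>. If
  \<open>B\<close> is such a subset of largest size, its span stays in \<open>P\<close>, so a vector
  of \<open>Q\<close> outside \<open>P\<close> can be added to \<open>B\<close> without losing
  independence.\<close>

lemma (in vectorspace) strict_mono_on_subspaces:
  assumes fin_dim
  obtains d :: "'c set \<Rightarrow> nat" where
    "\<And>P Q. VectorSpace.subspace K P V \<Longrightarrow> VectorSpace.subspace K Q V \<Longrightarrow> P \<subset> Q \<Longrightarrow> d P < d Q"
proof -
  define C where "C P = card ` {B. B \<subseteq> P \<and> B \<subseteq> carrier V \<and> lin_indpt B}" for P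
  have bound: "C P \<subseteq> {..dim}" for P using li_le_dim[OF assms] by (auto simp: C_def)
  then have fin: "finite (C P)" for P using finite_subset by blast
  \<comment> \<open>The empty set is independent, so the maximum is taken over a nonempty
    set.\<close>
  have empty: "0 \<in> C P" for P
    by (auto simp: C_def lin_dep_def intro!: image_eqI[of 0 card "{}"])
  have "Max (C P) < Max (C Q)" if P: "VectorSpace.subspace K P V" and Q: "VectorSpace.subspace K Q V" and PQ: "P \<subset> Q" for P Q
  proof -
    have "Max (C P) \<in> C P" using Max_in[OF fin] empty by blast
    then obtain B where B: "B \<subseteq> P" "B \<subseteq> carrier V" "lin_indpt B" "Max (C P) = card B"
      by (auto simp: C_def)
    obtain v where v: "v \<in> Q" "v \<notin> P" using PQ by blast
    have vV: "v \<in> carrier V" using v Q submodule.subset[of K Q V] by (auto simp: VectorSpace.subspace_def)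
    have "span B \<subseteq> P" using span_is_subset[OF B(1)] P by (simp add: VectorSpace.subspace_def)
    then have "lin_indpt (B \<union> {v})"
      using lin_dep_iff_in_span[OF B(2,3) vV] v B(1) by blast
    then have "card (B \<union> {v}) \<in> C Q" using B v vV PQ by (auto simp: C_def)
    moreover have "card (B \<union> {v}) = Suc (card B)"
      using v B(1) li_le_dim(1)[OF assms B(2,3)] by (simp add: subset_iff) (metis card_insert_disjoint)
    ultimately show ?thesis using Max_ge[OF fin, of "Suc (card B)" Q] B(4) by simp
  qed
  then show thesis by (rule that)
qed

text \<open>Generalises \<open>right_scalars\<close> from multiples of 1 to any map \<iota> into the
  acting ring. The tensor algebra is a bare \<open>ring\<close> record without scalar
  multiplication, so its modules become vector spaces in this way.\<close>

definition restrict_scalars :: "('k \<Rightarrow> 'a) \<Rightarrow> ('a, 'm, 'x) rmodule_scheme \<Rightarrow> ('k, 'm) module" where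
  "restrict_scalars \<iota> M =
     \<lparr>carrier = carrier M, monoid.mult = monoid.mult M, monoid.one = monoid.one M,
      ring.zero = ring.zero M, ring.add = ring.add M, module.smult = (\<lambda>k x. x \<triangleleft>\<^bsub>M\<^esub> \<iota> k)\<rparr>"

lemma restrict_scalars_simps [simp]:
  "carrier (restrict_scalars \<iota> M) = carrier M" "\<zero>\<^bsub>restrict_scalars \<iota> M\<^esub> = \<zero>\<^bsub>M\<^esub>"
  "x \<oplus>\<^bsub>restrict_scalars \<iota> M\<^esub> y = x \<oplus>\<^bsub>M\<^esub> y" "k \<odot>\<^bsub>restrict_scalars \<iota> M\<^esub> x = x \<triangleleft>\<^bsub>M\<^esub> \<iota> k"
  by (simp_all add: restrict_scalars_def)

lemma (in right_module) vectorspace_restrict_scalars: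
  assumes K: "field K" and \<iota>: "\<iota> \<in> ring_hom K A"
  shows "vectorspace K (restrict_scalars \<iota> M)"
proof -
  interpret K: field K by (rule K)
  have c: "\<iota> k \<in> carrier A" if "k \<in> carrier K" for k using ring_hom_closed[OF \<iota> that] .
  show ?thesis
  proof (rule vs_criteria[OF K]; (intro allI ballI impI)?)
    fix v assume "v \<in> carrier (restrict_scalars \<iota> M)"
    then show "\<exists>w\<in>carrier (restrict_scalars \<iota> M). v \<oplus>\<^bsub>restrict_scalars \<iota> M\<^esub> w = \<zero>\<^bsub>restrict_scalars \<iota> M\<^esub>"
      by (intro bexI[of _ "\<ominus>\<^bsub>M\<^esub> v"]) (simp_all add: M.r_neg)
  next
    fix k l v assume *: "k \<in> carrier K \<and> l \<in> carrier K \<and> v \<in> carrier (restrict_scalars \<iota> M)"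
    \<comment> \<open>Reading a right action as a left one reverses products; commutativity of
      \<open>K\<close> undoes the reversal.\<close>
    then have "\<iota> (k \<otimes>\<^bsub>K\<^esub> l) = \<iota> l \<otimes>\<^bsub>A\<^esub> \<iota> k"
      using ring_hom_mult[OF \<iota>, of l k] by (simp add: K.m_comm)
    then show "(k \<otimes>\<^bsub>K\<^esub> l) \<odot>\<^bsub>restrict_scalars \<iota> M\<^esub> v =
        k \<odot>\<^bsub>restrict_scalars \<iota> M\<^esub> (l \<odot>\<^bsub>restrict_scalars \<iota> M\<^esub> v)"
      using * c by (simp add: ract_assoc)
  qed (auto simp: c ract_closed ract_add_left ract_add_right ract_one M.a_ac
      ring_hom_one[OF \<iota>] ring_hom_add[OF \<iota>])
qed

lemma (in right_module) subspace_restrict_scalars: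
  assumes K: "field K" and \<iota>: "\<iota> \<in> ring_hom K A" and N: "rsubmodule A M N"
  shows "VectorSpace.subspace K N (restrict_scalars \<iota> M)"
proof -
  interpret V: vectorspace K "restrict_scalars \<iota> M"
    by (rule vectorspace_restrict_scalars[OF K \<iota>])
  have "submodule K N (restrict_scalars \<iota> M)"
    using N ring_hom_closed[OF \<iota>] V.module_axioms by (intro submodule.intro) (auto simp: rsubmodule_iff)
  then show ?thesis using V.vectorspace_axioms by (simp add: VectorSpace.subspace_def)
qed

lemma (in right_module) strict_mono_on_rsubmodules:
  assumes K: "field K" and \<iota>: "\<iota> \<in> ring_hom K A"
    and "vectorspace.fin_dim K (restrict_scalars \<iota> M)"
  obtains d :: "'m set \<Rightarrow> nat" where
    "\<And>P Q. rsubmodule A M P \<Longrightarrow> rsubmodule A M Q \<Longrightarrow> P \<subset> Q \<Longrightarrow> d P < d Q"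
proof -
  interpret V: vectorspace K "restrict_scalars \<iota> M"
    by (rule vectorspace_restrict_scalars[OF K \<iota>])
  show thesis
  proof (rule V.strict_mono_on_subspaces[OF assms(3)])
    fix d :: "'m set \<Rightarrow> nat"
    assume d: "\<And>P Q. VectorSpace.subspace K P (restrict_scalars \<iota> M) \<Longrightarrow>
      VectorSpace.subspace K Q (restrict_scalars \<iota> M) \<Longrightarrow> P \<subset> Q \<Longrightarrow> d P < d Q"
    show thesis
      by (rule that, rule d) (simp_all add: subspace_restrict_scalars[OF K \<iota>])
  qed
qed


section \<open>Modules over a finite dimensional algebra\<close>

lemma right_scalars_eq: "right_scalars A M = restrict_scalars (\<lambda>k. k \<odot>\<^bsub>A\<^esub> \<one>\<^bsub>A\<^esub>) M"
  by (simp add: right_scalars_def restrict_scalars_def)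

context fd_algebra
begin

lemma mult_scalar: assumes "k \<in> carrier K" "x \<in> carrier A"
  shows "x \<otimes>\<^bsub>A\<^esub> (k \<odot>\<^bsub>A\<^esub> \<one>\<^bsub>A\<^esub>) = k \<odot>\<^bsub>A\<^esub> x" "(k \<odot>\<^bsub>A\<^esub> \<one>\<^bsub>A\<^esub>) \<otimes>\<^bsub>A\<^esub> x = k \<odot>\<^bsub>A\<^esub> x"
  using smult_mult_right[of k x "\<one>\<^bsub>A\<^esub>"] smult_mult_left[of k "\<one>\<^bsub>A\<^esub>" x] assms by simp_all

lemma scalar_hom: "(\<lambda>k. k \<odot>\<^bsub>A\<^esub> \<one>\<^bsub>A\<^esub>) \<in> ring_hom K A"
  by (rule ring_hom_memI)
    (auto simp: mult_scalar(2) smult_l_distr smult_assoc1)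

text \<open>The coset map from \<open>A\<close> is onto, and it is linear because scalar
  multiplication on \<open>A\<close> agrees with right multiplication by multiples of 1. So finite
  dimension passes from \<open>A\<close> to the quotient.\<close>

lemma fin_dim_quot_regular:
  assumes I: "rsubmodule A (regular_rmodule A) I"
  shows "vectorspace.fin_dim K (right_scalars A (quot_rmodule (regular_rmodule A) I))"
proof -
  interpret R: right_module A "regular_rmodule A" by (rule A.right_module_regular)
  let ?Q = "quot_rmodule (regular_rmodule A) I" and ?\<pi> = "\<lambda>x. I +>\<^bsub>regular_rmodule A\<^esub> x"
  interpret Q: right_module A ?Q by (rule R.right_module_quot[OF I])
  have F: "field K" by (rule field_axioms)
  interpret W: vectorspace K "right_scalars A ?Q"
    unfolding right_scalars_eq by (rule Q.vectorspace_restrict_scalars[OF F scalar_hom])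
  have smult: "?\<pi> (k \<odot>\<^bsub>A\<^esub> x) = ?\<pi> x \<triangleleft>\<^bsub>?Q\<^esub> (k \<odot>\<^bsub>A\<^esub> \<one>\<^bsub>A\<^esub>)"
    if "k \<in> carrier K" "x \<in> carrier A" for k x
    using R.quot_ract[OF I, of x "k \<odot>\<^bsub>A\<^esub> \<one>\<^bsub>A\<^esub>"] that by (simp add: mult_scalar(1))
  have "?\<pi> \<in> LinearCombinations.module_hom K A (right_scalars A ?Q)"
    unfolding LinearCombinations.module_hom_def right_scalars_eq
    using R.quot_add[OF I] smult by (auto simp: R.quot_carrier[OF I])
  then interpret linear_map K A "right_scalars A ?Q" ?\<pi>
    by unfold_locales
  show ?thesis
    by (rule surj_fin_dim[OF finite_dimensional]) (simp add: right_scalars_eq R.quot_carrier[OF I])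
qed

end

lemma mod_simple_iso:
  fixes A :: "('k, 'a) module"
  assumes A: "fd_algebra K A" and S: "mod_simples K A S" and Y: "right_module A Y" "rmodule_simple A Y"
  shows "\<exists>i. rmodule_iso A Y (S i)"
proof -
  interpret fd_algebra K A by (rule A)
  interpret Y: right_module A Y by fact
  obtain I where I: "rsubmodule A (regular_rmodule A) I"
    "rmodule_iso A (quot_rmodule (regular_rmodule A) I) Y"
    "rmodule_simple A (quot_rmodule (regular_rmodule A) I)"
    by (rule Y.simple_cyclic[OF Y(2)])
  interpret Q: right_module A "quot_rmodule (regular_rmodule A) I"
    by (rule right_module.right_module_quot[OF A.right_module_regular I(1)])
  have "mod_object K A (quot_rmodule (regular_rmodule A) I)"
    using fin_dim_quot_regular[OF I(1)] Q.right_module_axioms by (simp add: mod_object_def)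
  then obtain i where "rmodule_iso A (quot_rmodule (regular_rmodule A) I) (S i)"
    using S I(3) unfolding mod_simples_def by blast
  then show ?thesis using rmodule_iso_trans[OF Q.rmodule_iso_sym[OF I(2)]] by blast
qed

section \<open>Modules over the tensor algebra\<close>

lemma (in mod_hom) image_in_span:
  assumes B: "B \<subseteq> carrier M" and v: "v \<in> M.span B"
  shows "f v \<in> N.span (f ` B)"
proof -
  have fB: "f ` B \<subseteq> carrier N" using B f_im by blast
  note sub = N.span_is_submodule[OF fB]
  have "submodule R {v \<in> carrier M. f v \<in> N.span (f ` B)} M"
    using M.module_axioms submodule.m_closed[OF sub] submodule.zero_closed[OF sub] submodule.smult_closed[OF sub]
    by (intro submodule.intro) auto
  moreover have "B \<subseteq> {v \<in> carrier M. f v \<in> N.span (f ` B)}"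
    using B N.in_own_span[OF fB] by blast
  ultimately show ?thesis using M.span_is_subset v by blast
qed

lemma (in linear_map) fin_dim_image_in_span:
  assumes V.fin_dim
  obtains B where "finite B" "B \<subseteq> carrier W" "\<And>v. v \<in> carrier V \<Longrightarrow> T v \<in> W.module.span B"
proof -
  obtain C where "finite C" "C \<subseteq> carrier V" "V.module.span C = carrier V"
    using assms by (auto simp: V.fin_dim_def)
  then show thesis using that[of "T ` C"] image_in_span[of C] by auto
qed

text \<open>Applied with \<open>P x B\<close> saying that certain vectors attached to
  \<open>x\<close> lie in the span of \<open>B\<close>, a condition monotone in \<open>B\<close>.
  The union of the finitely many witnesses then serves all \<open>x\<close> at once.\<close>

lemma finite_union_of_witnesses:
  assumes "finite I" and "\<And>x. x \<in> I \<Longrightarrow> \<exists>B. finite B \<and> B \<subseteq> C \<and> P x B"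
    and "\<And>x B B'. x \<in> I \<Longrightarrow> B \<subseteq> B' \<Longrightarrow> P x B \<Longrightarrow> P x B'"
  shows "\<exists>B. finite B \<and> B \<subseteq> C \<and> (\<forall>x\<in>I. P x B)"
proof -
  obtain f where f: "\<forall>x\<in>I. finite (f x) \<and> f x \<subseteq> C \<and> P x (f x)"
    using bchoice[of I "\<lambda>x B. finite B \<and> B \<subseteq> C \<and> P x B"] assms(2) by blast
  have "\<forall>x\<in>I. P x (\<Union> (f ` I))" using f assms(3) by (meson UN_upper)
  then show ?thesis using f assms(1) by (intro exI[of _ "\<Union> (f ` I)"]) auto
qed

section \<open>The ground field inside the tensor algebra\<close>

context modulated_quiver
begin

abbreviation scalar :: "'n \<Rightarrow> 'k \<Rightarrow> 'f" where
  "scalar i k \<equiv> k \<odot>\<^bsub>F i\<^esub> \<one>\<^bsub>F i\<^esub>"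

lemmas scalar_ring_hom = fd_algebra.scalar_hom[OF F_algebra]

lemma scalar_closed: "k \<in> carrier K \<Longrightarrow> scalar i k \<in> carrier (F i)"
  using ring_hom_closed[OF scalar_ring_hom[of i]] by simp

lemmas scalar_hom_simps = scalar_closed ring_hom_one[OF scalar_ring_hom] ring_hom_add[OF scalar_ring_hom]
  ring_hom_mult[OF scalar_ring_hom]

text \<open>A representative of \<open>k\<close> times the unit of the tensor algebra: the scalar
  \<open>k\<close> placed at every vertex.\<close>

definition diag :: "'k \<Rightarrow> ('n, 'f, 'e) tensor_word \<Rightarrow>\<^sub>0 int" where
  "diag k = (\<Sum>i\<in>UNIV. frag_of (Scalar i (scalar i k)))"

lemma diag_keys: "k \<in> carrier K \<Longrightarrow> Poly_Mapping.keys (diag k) \<subseteq> W"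
  unfolding diag_def
  by (rule order_trans[OF keys_sum]) (auto simp: Scalar_in_tensor_words scalar_closed)

text \<open>In this product and the next two, words with different vertices multiply to 0, so a
  single summand of \<open>diag k\<close> survives.\<close>

lemma tm_Scalar_diag: "tm (frag_of (Scalar j f)) (diag k) = frag_of (Scalar j (f \<otimes>\<^bsub>F j\<^esub> scalar j k))"
  by (simp add: diag_def tm_sum_right tensor_mult_of)

lemma tm_edge_diag: "tm (frag_of (Tensor [(i, j, e)])) (diag k) = frag_of (Tensor [(i, j, e \<triangleleft>\<^bsub>E i j\<^esub> scalar j k)])"
  by (simp add: diag_def tm_sum_right tensor_mult_of)

lemma tm_diag_edge: "tm (diag k) (frag_of (Tensor [(i, j, e)])) = frag_of (Tensor [(i, j, scalar i k \<triangleright>\<^bsub>E i j\<^esub> e)])"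
  by (simp add: diag_def tm_sum_left tensor_mult_of)

lemma N_sum: "finite I \<Longrightarrow> (\<And>i. i \<in> I \<Longrightarrow> f i \<in> tensor_null F E) \<Longrightarrow> (\<Sum>i\<in>I. f i) \<in> tensor_null F E"
  by (induction I rule: finite_induct) (auto simp: N0 N_add)

text \<open>Products and the unit agree already in the free abelian group. Sums agree only modulo
  \<open>tensor_null F E\<close>, because each \<open>Scalar i f\<close> is a formal generator; the
  discrepancy is a sum of relations, one for each vertex.\<close>

lemma diag_ring_hom: "(\<lambda>k. cs (diag k)) \<in> ring_hom K T"
proof (rule ring_hom_memI)
  fix k assume k: "k \<in> carrier K"
  show "cs (diag k) \<in> carrier T" using diag_keys[OF k] by (auto simp: T_carrier)
  fix l assume l: "l \<in> carrier K"
  have "tm (diag k) (diag l) = (\<Sum>i\<in>UNIV. frag_of (Scalar i (scalar i k \<otimes>\<^bsub>F i\<^esub> scalar i l)))"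
    by (subst (1) diag_def) (simp add: tm_sum_left tm_Scalar_diag)
  also have "\<dots> = diag (k \<otimes> l)" using k l by (simp add: diag_def scalar_hom_simps)
  finally show "cs (diag (k \<otimes> l)) = cs (diag k) \<otimes>\<^bsub>T\<^esub> cs (diag l)"
    using T_mult[OF diag_keys[OF k] diag_keys[OF l]] by simp
  have "diag (k \<oplus> l) - (diag k + diag l) = (\<Sum>i\<in>UNIV. frag_of (Scalar i (scalar i k \<oplus>\<^bsub>F i\<^esub> scalar i l))
      - frag_of (Scalar i (scalar i k)) - frag_of (Scalar i (scalar i l)))"
    using k l by (simp add: diag_def scalar_hom_simps sum_subtractf)
  also have "\<dots> \<in> tensor_null F E" using k l by (intro N_sum rel1 scalar_closed) auto
  finally have "cs (diag (k \<oplus> l)) = cs (diag k + diag l)"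
    using k l by (intro cs_eqI keysW_add diag_keys) auto
  then show "cs (diag (k \<oplus> l)) = cs (diag k) \<oplus>\<^bsub>T\<^esub> cs (diag l)"
    using T_add[OF diag_keys[OF k] diag_keys[OF l]] by simp
next
  show "cs (diag \<one>) = \<one>\<^bsub>T\<^esub>" by (simp add: diag_def T_one scalar_hom_simps)
qed

lemma vectorspace_edge: "vectorspace K (left_scalars (F i) (E i j))"
proof -
  interpret Eij: abelian_group "E i j" by (rule Eg)
  show ?thesis
  proof (rule vs_criteria; (intro allI ballI impI)?)
    show "field K" by (rule field_axioms)
    {
      fix v assume "v \<in> carrier (left_scalars (F i) (E i j))"
      then show "\<exists>w\<in>carrier (left_scalars (F i) (E i j)). v \<oplus>\<^bsub>left_scalars (F i) (E i j)\<^esub> w = \<zero>\<^bsub>left_scalars (F i) (E i j)\<^esub>"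
        by (intro bexI[of _ "\<ominus>\<^bsub>E i j\<^esub> v"]) (simp_all add: left_scalars_def Eij.r_neg)
    }
  qed (auto simp: left_scalars_def E_lact E_add scalar_hom_simps Elaws
        Eij.a_ac abelian_groupE[OF Eg])
qed

end

section \<open>Finite dimension of finitely generated nilpotent modules\<close>

context modulated_quiver
begin

context
  fixes M :: "((('n, 'f, 'e) tensor_word \<Rightarrow>\<^sub>0 int) set, 'm) rmodule"
  assumes M: "right_module T M"
begin

interpretation M: right_module T M by (rule M)

abbreviation act :: "'m \<Rightarrow> (('n, 'f, 'e) tensor_word \<Rightarrow>\<^sub>0 int) \<Rightarrow> 'm" (infixl \<open>\<bullet>\<bullet>\<close> 70) where
  "x \<bullet>\<bullet> u \<equiv> x \<triangleleft>\<^bsub>M\<^esub> cs u"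

lemma cs_closed: "Poly_Mapping.keys u \<subseteq> W \<Longrightarrow> cs u \<in> carrier T"
  by (auto simp: T_carrier)

lemma act_closed: "x \<in> carrier M \<Longrightarrow> Poly_Mapping.keys u \<subseteq> W \<Longrightarrow> x \<bullet>\<bullet> u \<in> carrier M"
  by (simp add: M.ract_closed cs_closed)

lemma act_add: assumes "x \<in> carrier M" "Poly_Mapping.keys u \<subseteq> W" "Poly_Mapping.keys v \<subseteq> W"
  shows "x \<bullet>\<bullet> (u + v) = x \<bullet>\<bullet> u \<oplus>\<^bsub>M\<^esub> x \<bullet>\<bullet> v"
  using M.ract_add_right[OF assms(1) cs_closed[OF assms(2)] cs_closed[OF assms(3)]]
  by (simp add: T_add[OF assms(2,3)])

lemma act_mult: assumes "x \<in> carrier M" "Poly_Mapping.keys u \<subseteq> W" "Poly_Mapping.keys v \<subseteq> W"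
  shows "x \<bullet>\<bullet> tm u v = x \<bullet>\<bullet> u \<bullet>\<bullet> v"
  using M.ract_assoc[OF assms(1) cs_closed[OF assms(2)] cs_closed[OF assms(3)]]
  by (simp add: T_mult[OF assms(2,3)])

lemma act_zero: "x \<in> carrier M \<Longrightarrow> x \<bullet>\<bullet> 0 = \<zero>\<^bsub>M\<^esub>"
  using M.ract_zero_right by (simp add: T_zero)

text \<open>Written with the subtrahend on the left-hand side, the form that
  \<open>V_span_diff\<close> takes in the difference case of \<open>frag_induction\<close>.\<close>

lemma act_diff: assumes "x \<in> carrier M" "Poly_Mapping.keys u \<subseteq> W" "Poly_Mapping.keys v \<subseteq> W"
  shows "x \<bullet>\<bullet> (u - v) \<oplus>\<^bsub>M\<^esub> x \<bullet>\<bullet> v = x \<bullet>\<bullet> u"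
  using act_add[OF assms(1) keysW_diff[OF assms(2,3)] assms(3)] by simp

abbreviation V where "V \<equiv> restrict_scalars (\<lambda>k. cs (diag k)) M"

interpretation V: vectorspace K V
  by (rule M.vectorspace_restrict_scalars[OF field_axioms diag_ring_hom])

lemma V_submoduleI:
  assumes "P \<subseteq> carrier M" "\<zero>\<^bsub>M\<^esub> \<in> P" "\<And>x y. x \<in> P \<Longrightarrow> y \<in> P \<Longrightarrow> x \<oplus>\<^bsub>M\<^esub> y \<in> P"
    "\<And>x k. x \<in> P \<Longrightarrow> k \<in> carrier K \<Longrightarrow> x \<bullet>\<bullet> diag k \<in> P"
  shows "submodule K P V"
  using assms V.module_axioms by (intro submodule.intro) auto

lemma V_span:
  assumes "B \<subseteq> carrier M"
  shows "V.span B \<subseteq> carrier M" "B \<subseteq> V.span B" "\<zero>\<^bsub>M\<^esub> \<in> V.span B"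
    "x \<in> V.span B \<Longrightarrow> y \<in> V.span B \<Longrightarrow> x \<oplus>\<^bsub>M\<^esub> y \<in> V.span B"
    "x \<in> V.span B \<Longrightarrow> k \<in> carrier K \<Longrightarrow> x \<bullet>\<bullet> diag k \<in> V.span B"
  using assms V.span_is_submodule[of B] submodule.subset[of K "V.span B" V] V.in_own_span[of B]
    submodule.zero_closed[of K "V.span B" V] submodule.m_closed[of K "V.span B" V x y]
    submodule.smult_closed[of K "V.span B" V k x]
  by simp_all

lemma V_span_diff:
  assumes B: "B \<subseteq> carrier M" and "x \<in> carrier M" "y \<in> V.span B" "x \<oplus>\<^bsub>M\<^esub> y \<in> V.span B"
  shows "x \<in> V.span B"
  using V.span_add[of B y x] assms V_span(1)[OF B] by (simp add: M.M.a_comm subset_iff)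

text \<open>Acting on \<open>x\<close> by \<open>Scalar j f\<close> is linear in \<open>f\<close>:
  additivity comes from \<open>rel1\<close>, homogeneity from multiplication by
  \<open>diag k\<close>. Since \<open>F j\<close> is finite dimensional, the image lies in the span
  of a finite set.\<close>

lemma vertex_span:
  assumes x: "x \<in> carrier M"
  obtains B where "finite B" "B \<subseteq> carrier M"
    "\<And>f. f \<in> carrier (F j) \<Longrightarrow> x \<bullet>\<bullet> frag_of (Scalar j f) \<in> V.span B"
proof -
  interpret Fj: fd_algebra K "F j" by (rule F_algebra)
  have keys: "Poly_Mapping.keys (frag_of (Scalar j f)) \<subseteq> W" if "f \<in> carrier (F j)" for f
    using that by (simp add: Scalar_in_tensor_words)
  have "(\<lambda>f. x \<bullet>\<bullet> frag_of (Scalar j f)) \<in> LinearCombinations.module_hom K (F j) V"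
    unfolding LinearCombinations.module_hom_def
  proof (intro CollectI conjI allI impI Pi_I)
    fix f assume "f \<in> carrier (F j)"
    then show "x \<bullet>\<bullet> frag_of (Scalar j f) \<in> carrier V" using act_closed[OF x keys] by simp
  next
    fix f g assume fg: "f \<in> carrier (F j) \<and> g \<in> carrier (F j)"
    then have "cs (frag_of (Scalar j (f \<oplus>\<^bsub>F j\<^esub> g))) = cs (frag_of (Scalar j f) + frag_of (Scalar j g))"
      using rel1[of f j g] by (intro cs_eqI keysW_add keys) (auto simp: diff_diff_add F_add)
    then show "x \<bullet>\<bullet> frag_of (Scalar j (f \<oplus>\<^bsub>F j\<^esub> g)) =
        x \<bullet>\<bullet> frag_of (Scalar j f) \<oplus>\<^bsub>V\<^esub> x \<bullet>\<bullet> frag_of (Scalar j g)"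
      using act_add[OF x keys keys] fg by simp
  next
    fix k f assume kf: "k \<in> carrier K \<and> f \<in> carrier (F j)"
    then have "frag_of (Scalar j (k \<odot>\<^bsub>F j\<^esub> f)) = tm (frag_of (Scalar j f)) (diag k)"
      by (simp add: tm_Scalar_diag Fj.mult_scalar)
    then show "x \<bullet>\<bullet> frag_of (Scalar j (k \<odot>\<^bsub>F j\<^esub> f)) = k \<odot>\<^bsub>V\<^esub> (x \<bullet>\<bullet> frag_of (Scalar j f))"
      using act_mult[OF x keys diag_keys] kf by simp
  qed
  then interpret linear_map K "F j" V "\<lambda>f. x \<bullet>\<bullet> frag_of (Scalar j f)"
    by unfold_locales
  show thesis
    by (rule fin_dim_image_in_span[OF Fj.finite_dimensional], rule that) simp_all
qed

lemma edge_span: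
  assumes x: "x \<in> carrier M"
  obtains B where "finite B" "B \<subseteq> carrier M"
    "\<And>e. e \<in> carrier (E i j) \<Longrightarrow> x \<bullet>\<bullet> frag_of (Tensor [(i, j, e)]) \<in> V.span B"
proof -
  interpret Eij: vectorspace K "left_scalars (F i) (E i j)" by (rule vectorspace_edge)
  have keys: "Poly_Mapping.keys (frag_of (Tensor [(i, j, e)])) \<subseteq> W" if "e \<in> carrier (E i j)" for e
    using that by (simp add: Tensor_in_tensor_words composable_simps)
  have "(\<lambda>e. x \<bullet>\<bullet> frag_of (Tensor [(i, j, e)])) \<in> LinearCombinations.module_hom K (left_scalars (F i) (E i j)) V"
    unfolding LinearCombinations.module_hom_def
  proof (intro CollectI conjI allI impI Pi_I)
    fix e assume "e \<in> carrier (left_scalars (F i) (E i j))"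
    then show "x \<bullet>\<bullet> frag_of (Tensor [(i, j, e)]) \<in> carrier V"
      using act_closed[OF x keys] by (simp add: left_scalars_def)
  next
    fix e e' assume "e \<in> carrier (left_scalars (F i) (E i j)) \<and> e' \<in> carrier (left_scalars (F i) (E i j))"
    then have e: "e \<in> carrier (E i j)" "e' \<in> carrier (E i j)" by (simp_all add: left_scalars_def)
    then have "cs (frag_of (Tensor [(i, j, e \<oplus>\<^bsub>E i j\<^esub> e')])) =
        cs (frag_of (Tensor [(i, j, e)]) + frag_of (Tensor [(i, j, e')]))"
      using rel2[of "[]" i j e "[]" e'] keys
      by (intro cs_eqI keysW_add keys) (auto simp: diff_diff_add E_add)
    then show "x \<bullet>\<bullet> frag_of (Tensor [(i, j, e \<oplus>\<^bsub>left_scalars (F i) (E i j)\<^esub> e')]) =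
        x \<bullet>\<bullet> frag_of (Tensor [(i, j, e)]) \<oplus>\<^bsub>V\<^esub> x \<bullet>\<bullet> frag_of (Tensor [(i, j, e')])"
      using act_add[OF x keys keys] e by (simp add: left_scalars_def)
  next
    fix k e assume "k \<in> carrier K \<and> e \<in> carrier (left_scalars (F i) (E i j))"
    then have ke: "k \<in> carrier K" "e \<in> carrier (E i j)" by (simp_all add: left_scalars_def)
    \<comment> \<open>\<open>left_scalars\<close> multiplies the edge from the left, while the
      vector space \<open>V\<close> multiplies after the edge has acted, hence from the right.
      \<open>E_central\<close> identifies the two.\<close>
    then have "frag_of (Tensor [(i, j, scalar i k \<triangleright>\<^bsub>E i j\<^esub> e)]) = tm (frag_of (Tensor [(i, j, e)])) (diag k)"
      by (simp add: tm_edge_diag E_central)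
    then show "x \<bullet>\<bullet> frag_of (Tensor [(i, j, k \<odot>\<^bsub>left_scalars (F i) (E i j)\<^esub> e)]) =
        k \<odot>\<^bsub>V\<^esub> (x \<bullet>\<bullet> frag_of (Tensor [(i, j, e)]))"
      using act_mult[OF x keys diag_keys] ke by (simp add: left_scalars_def)
  qed
  then interpret linear_map K "left_scalars (F i) (E i j)" V "\<lambda>e. x \<bullet>\<bullet> frag_of (Tensor [(i, j, e)])"
    by unfold_locales
  show thesis
    by (rule fin_dim_image_in_span[OF E_fin_dim], rule that) (simp_all add: left_scalars_def)
qed

text \<open>Left and right scalars agree on \<open>E i j\<close>, so that acting by an edge is linear in the module
  argument as well.\<close>

lemma edges_of_span:
  assumes B: "finite B" "B \<subseteq> carrier M"
  obtains B' where "finite B'" "B' \<subseteq> carrier M"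
    "\<And>v i j e. v \<in> V.span B \<Longrightarrow> e \<in> carrier (E i j) \<Longrightarrow> v \<bullet>\<bullet> frag_of (Tensor [(i, j, e)]) \<in> V.span B'"
proof -
  let ?P = "\<lambda>(v, i, j) B'. \<forall>e\<in>carrier (E i j). v \<bullet>\<bullet> frag_of (Tensor [(i, j, e)]) \<in> V.span B'"
  have "\<exists>B'. finite B' \<and> B' \<subseteq> carrier M \<and> (\<forall>y\<in>B \<times> UNIV \<times> UNIV. ?P y B')"
  proof (rule finite_union_of_witnesses)
    show "finite (B \<times> (UNIV :: 'n set) \<times> (UNIV :: 'n set))" using B by simp
  next
    fix y assume y: "y \<in> B \<times> (UNIV :: 'n set) \<times> (UNIV :: 'n set)"
    obtain v i j where v: "y = (v, i, j)" by (cases y)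
    then have "v \<in> carrier M" using y B by auto
    then obtain B' where "finite B'" "B' \<subseteq> carrier M"
      "\<And>e. e \<in> carrier (E i j) \<Longrightarrow> v \<bullet>\<bullet> frag_of (Tensor [(i, j, e)]) \<in> V.span B'"
      by (rule edge_span[of v i j]) auto
    then show "\<exists>B'. finite B' \<and> B' \<subseteq> carrier M \<and> ?P y B'"
      unfolding v by (intro exI[of _ B']) simp
  next
    fix y B' B'' assume "B' \<subseteq> B''" "?P y B'"
    then show "?P y B''" using V.span_is_monotone[of B' B''] by (auto split: prod.splits)
  qed
  then obtain B' where B': "finite B'" "B' \<subseteq> carrier M" and gen: "\<And>v i j e. v \<in> B \<Longrightarrow> e \<in> carrier (E i j) \<Longrightarrow>
      v \<bullet>\<bullet> frag_of (Tensor [(i, j, e)]) \<in> V.span B'"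
    by auto
  show thesis
  proof (rule that[OF B'])
    fix v i j e assume v: "v \<in> V.span B" and e: "e \<in> carrier (E i j)"
    \<comment> \<open>The quantifier over all edges from \<open>i\<close> to \<open>j\<close> makes
      this set closed under scalars: a factor \<open>diag k\<close> in front of \<open>e\<close> is
      absorbed into \<open>e\<close>, which stays in \<open>E i j\<close>.\<close>
    let ?P = "{v \<in> carrier M. \<forall>e\<in>carrier (E i j). v \<bullet>\<bullet> frag_of (Tensor [(i, j, e)]) \<in> V.span B'}"
    have keys: "Poly_Mapping.keys (frag_of (Tensor [(i, j, e)])) \<subseteq> W" if "e \<in> carrier (E i j)" for e
      using that by (simp add: Tensor_in_tensor_words composable_simps)
    have "submodule K ?P V"
    proof (rule V_submoduleI)
      show "\<zero>\<^bsub>M\<^esub> \<in> ?P" using V_span(3)[OF B'(2)] by (auto simp: M.ract_zero_left cs_closed[OF keys])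
    next
      fix x y assume "x \<in> ?P" "y \<in> ?P"
      then show "x \<oplus>\<^bsub>M\<^esub> y \<in> ?P"
        using V_span(4)[OF B'(2)] by (auto simp: M.ract_add_left cs_closed[OF keys])
    next
      fix x k assume x: "x \<in> ?P" and k: "k \<in> carrier K"
      have "x \<bullet>\<bullet> diag k \<bullet>\<bullet> frag_of (Tensor [(i, j, e)]) \<in> V.span B'" if e: "e \<in> carrier (E i j)" for e
      proof -
        have "x \<bullet>\<bullet> diag k \<bullet>\<bullet> frag_of (Tensor [(i, j, e)]) = x \<bullet>\<bullet> tm (diag k) (frag_of (Tensor [(i, j, e)]))"
          using act_mult[OF _ diag_keys[OF k] keys[OF e]] x by simp
        also have "\<dots> = x \<bullet>\<bullet> frag_of (Tensor [(i, j, scalar i k \<triangleright>\<^bsub>E i j\<^esub> e)])"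
          by (simp add: tm_diag_edge)
        also have "\<dots> \<in> V.span B'" using x e k by (simp add: E_lact scalar_closed)
        finally show ?thesis .
      qed
      then show "x \<bullet>\<bullet> diag k \<in> ?P" using x act_closed[OF _ diag_keys[OF k]] by simp
    qed auto
    moreover have "B \<subseteq> ?P" using B gen by auto
    ultimately have "V.span B \<subseteq> ?P" using V.span_is_subset by blast
    then show "v \<bullet>\<bullet> frag_of (Tensor [(i, j, e)]) \<in> V.span B'" using v e by blast
  qed
qed

text \<open>In degree 0 there are finitely many generators and vertices, each giving a finite
  dimensional image. Every further degree appends one edge and costs one use of
  \<open>edges_of_span\<close>.\<close>

lemma words_span:
  assumes X: "finite X" "X \<subseteq> carrier M"
  shows "\<exists>B. finite B \<and> B \<subseteq> carrier M \<and>
    (\<forall>g\<in>X. \<forall>w\<in>W. degree_word w = n \<longrightarrow> g \<bullet>\<bullet> frag_of w \<in> V.span B)"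
proof (induction n)
  case 0
  let ?P = "\<lambda>(g, j) B. \<forall>f\<in>carrier (F j). g \<bullet>\<bullet> frag_of (Scalar j f) \<in> V.span B"
  have "\<exists>B. finite B \<and> B \<subseteq> carrier M \<and> (\<forall>y\<in>X \<times> UNIV. ?P y B)"
  proof (rule finite_union_of_witnesses)
    show "finite (X \<times> (UNIV :: 'n set))" using X by simp
  next
    fix y assume y: "y \<in> X \<times> (UNIV :: 'n set)"
    obtain g j where g: "y = (g, j)" by (cases y)
    then have "g \<in> carrier M" using y X by auto
    then obtain B where "finite B" "B \<subseteq> carrier M"
      "\<And>f. f \<in> carrier (F j) \<Longrightarrow> g \<bullet>\<bullet> frag_of (Scalar j f) \<in> V.span B"
      by (rule vertex_span[of g j]) auto
    then show "\<exists>B. finite B \<and> B \<subseteq> carrier M \<and> ?P y B"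
      unfolding g by (intro exI[of _ B]) simp
  next
    fix y B B' assume "B \<subseteq> B'" "?P y B"
    then show "?P y B'" using V.span_is_monotone[of B B'] by (auto split: prod.splits)
  qed
  then obtain B where B: "finite B" "B \<subseteq> carrier M"
    "\<And>g j f. g \<in> X \<Longrightarrow> f \<in> carrier (F j) \<Longrightarrow> g \<bullet>\<bullet> frag_of (Scalar j f) \<in> V.span B"
    by auto
  have "g \<bullet>\<bullet> frag_of w \<in> V.span B" if "g \<in> X" "w \<in> W" "degree_word w = 0" for g w
    using that B(3) by (cases w) (auto simp: Scalar_in_tensor_words Tensor_in_tensor_words)
  then show ?case using B by blast
next
  case (Suc n)
  then obtain B where B: "finite B" "B \<subseteq> carrier M"
    "\<And>g w. g \<in> X \<Longrightarrow> w \<in> W \<Longrightarrow> degree_word w = n \<Longrightarrow> g \<bullet>\<bullet> frag_of w \<in> V.span B"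
    by blast
  \<comment> \<open>\<open>X\<close> is included for words of degree 1: the empty tensor is not a
    word, so the only edge of such a word acts on the generator itself.\<close>
  have BX: "finite (X \<union> B)" "X \<union> B \<subseteq> carrier M" using B X by auto
  obtain B' where B': "finite B'" "B' \<subseteq> carrier M"
    "\<And>v i j e. v \<in> V.span (X \<union> B) \<Longrightarrow> e \<in> carrier (E i j) \<Longrightarrow> v \<bullet>\<bullet> frag_of (Tensor [(i, j, e)]) \<in> V.span B'"
    by (rule edges_of_span[OF BX]) auto
  have "g \<bullet>\<bullet> frag_of w \<in> V.span B'" if g: "g \<in> X" and w: "w \<in> W" "degree_word w = Suc n" for g w
  proof -
    obtain q where q: "w = Tensor q" using w by (cases w) auto
    obtain i j e p where p: "q = p @ [(i, j, e)]" "e \<in> carrier (E i j)" "composable E p"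
      "p \<noteq> [] \<longrightarrow> fst (snd (last p)) = i"
      using lastE w q by metis
    show ?thesis
    proof (cases "p = []")
      case True
      have "g \<in> V.span (X \<union> B)" using V_span(2)[OF BX(2)] g by blast
      then show ?thesis using B'(3)[of g e i j] p q True by simp
    next
      case False
      have pW: "Tensor p \<in> W" using False p by (simp add: Tensor_in_tensor_words)
      have "frag_of w = tm (frag_of (Tensor p)) (frag_of (Tensor [(i, j, e)]))"
        using False p q by (simp add: tensor_mult_of)
      then have "g \<bullet>\<bullet> frag_of w = g \<bullet>\<bullet> frag_of (Tensor p) \<bullet>\<bullet> frag_of (Tensor [(i, j, e)])"
        using act_mult[of g "frag_of (Tensor p)" "frag_of (Tensor [(i, j, e)])"] g X pW p
        by (auto simp: Tensor_in_tensor_words composable_simps)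
      moreover have "g \<bullet>\<bullet> frag_of (Tensor p) \<in> V.span (X \<union> B)"
        using B(3)[OF g pW] V.span_is_monotone[of B "X \<union> B"] w p q by auto
      ultimately show ?thesis using B'(3) p(2) by simp
    qed
  qed
  then show ?case using B' by blast
qed

text \<open>A word acts as its edges one after another. This is the iterated action in terms of
  which \<open>acts_nilpotently\<close> is formulated.\<close>

lemma foldl_letters:
  assumes "x \<in> carrier M" "p \<noteq> []" "composable E p"
  shows "foldl (ract M) x (map (\<lambda>c. cs (frag_of (Tensor [c]))) p) = x \<bullet>\<bullet> frag_of (Tensor p)"
  using assms(2,3)
proof (induction p rule: rev_nonempty_induct)
  case (snoc c p)
  then have "Tensor p \<in> W" "Tensor [c] \<in> W" "fst (snd (last p)) = fst c"
    by (auto simp: Tensor_in_tensor_words composable_append)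
  then show ?case
    using snoc act_mult[OF assms(1), of "frag_of (Tensor p)" "frag_of (Tensor [c])"]
    by (simp add: composable_append tensor_mult_of)
qed simp

lemma long_words_vanish:
  assumes k: "\<And>x rs. x \<in> carrier M \<Longrightarrow> length rs = k \<Longrightarrow> set rs \<subseteq> tensor_radical F E \<Longrightarrow>
      foldl (ract M) x rs = \<zero>\<^bsub>M\<^esub>"
    and x: "x \<in> carrier M" and w: "w \<in> W" "k < degree_word w"
  shows "x \<bullet>\<bullet> frag_of w = \<zero>\<^bsub>M\<^esub>"
proof -
  \<comment> \<open>The strict bound excludes words of the form \<open>Scalar i f\<close> even for
    \<open>k = 0\<close>.\<close>
  obtain p where p: "w = Tensor p" "k < length p" using w by (cases w) auto
  then have c: "composable E p" "p \<noteq> []" using w by (auto simp: Tensor_in_tensor_words)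
  let ?rs = "map (\<lambda>c. cs (frag_of (Tensor [c]))) p"
  have letters: "Tensor [c] \<in> W" if "c \<in> set p" for c
    using c that by (auto simp: Tensor_in_tensor_words composable_def)
  have rad: "set ?rs \<subseteq> tensor_radical F E"
  proof
    fix r assume "r \<in> set ?rs"
    then obtain c where "c \<in> set p" "r = cs (frag_of (Tensor [c]))" by auto
    then show "r \<in> tensor_radical F E" using letters[of c]
      unfolding tensor_radical_def by (intro CollectI exI[of _ "frag_of (Tensor [c])"]) simp
  qed
  have car: "set ?rs \<subseteq> carrier T" using letters by (auto intro!: cs_closed simp del: split_paired_All)
  \<comment> \<open>Nilpotency concerns lists of length exactly \<open>k\<close>: the first
    \<open>k\<close> edges already give zero, and the remaining ones keep it.\<close>
  have "foldl (ract M) x ?rs = foldl (ract M) (foldl (ract M) x (take k ?rs)) (drop k ?rs)"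
    by (metis append_take_drop_id foldl_append)
  also have "foldl (ract M) x (take k ?rs) = \<zero>\<^bsub>M\<^esub>"
    using rad p set_take_subset[of k ?rs] by (intro k[OF x]) auto
  also have "foldl (ract M) \<zero>\<^bsub>M\<^esub> (drop k ?rs) = \<zero>\<^bsub>M\<^esub>"
    by (rule M.foldl_ract_zero) (use car set_drop_subset[of k ?rs] in blast)
  finally show ?thesis using foldl_letters[OF x c(2,1)] p by simp
qed

lemma nilpotent_fin_dim:
  assumes fg: "rmodule_fin_gen T M" and nil: "acts_nilpotently (tensor_radical F E) M"
  shows V.fin_dim
proof -
  obtain X where X: "finite X" "X \<subseteq> carrier M" "\<And>P. rsubmodule T M P \<Longrightarrow> X \<subseteq> P \<Longrightarrow> P = carrier M"
    using fg unfolding rmodule_fin_gen_def by blast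
  obtain k where k: "\<And>x rs. x \<in> carrier M \<Longrightarrow> length rs = k \<Longrightarrow> set rs \<subseteq> tensor_radical F E \<Longrightarrow>
      foldl (ract M) x rs = \<zero>\<^bsub>M\<^esub>"
    using nil unfolding acts_nilpotently_def by blast
  have "\<exists>B. finite B \<and> B \<subseteq> carrier M \<and> (\<forall>n\<in>{..k}. \<forall>g\<in>X. \<forall>w\<in>W. degree_word w = n \<longrightarrow>
      g \<bullet>\<bullet> frag_of w \<in> V.span B)"
  proof (rule finite_union_of_witnesses)
    fix n and B B' :: "'m set" assume "B \<subseteq> B'" and
      *: "\<forall>g\<in>X. \<forall>w\<in>W. degree_word w = n \<longrightarrow> g \<bullet>\<bullet> frag_of w \<in> V.span B"
    then have "V.span B \<subseteq> V.span B'" by (intro V.span_is_monotone)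
    then show "\<forall>g\<in>X. \<forall>w\<in>W. degree_word w = n \<longrightarrow> g \<bullet>\<bullet> frag_of w \<in> V.span B'" using * by blast
  qed (use words_span[OF X(1,2)] in auto)
  then obtain B where B: "finite B" "B \<subseteq> carrier M"
    and short: "\<And>g w. g \<in> X \<Longrightarrow> w \<in> W \<Longrightarrow> degree_word w \<le> k \<Longrightarrow> g \<bullet>\<bullet> frag_of w \<in> V.span B"
    by auto
  have word: "g \<bullet>\<bullet> frag_of w \<in> V.span B" if g: "g \<in> X" and w: "w \<in> W" for g w
  proof (cases "degree_word w \<le> k")
    case False
    then have "g \<bullet>\<bullet> frag_of w = \<zero>\<^bsub>M\<^esub>" using g X(2) w by (intro long_words_vanish[OF k]) auto
    then show ?thesis using V_span(3)[OF B(2)] by simp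
  qed (use short g w in blast)
  have gen: "g \<bullet>\<bullet> u \<in> V.span B" if g: "g \<in> X" and u: "Poly_Mapping.keys u \<subseteq> W" for g u
  proof -
    have gM: "g \<in> carrier M" using g X(2) by blast
    \<comment> \<open>The support condition is carried through the induction, because the difference
      case needs it to split the action on \<open>u - v\<close>.\<close>
    have "Poly_Mapping.keys u \<subseteq> W \<and> g \<bullet>\<bullet> u \<in> V.span B"
      using u
    proof (induction u rule: frag_induction)
      case zero
      show ?case using V_span(3)[OF B(2)] by (simp add: act_zero gM)
    next
      case (one w)
      then show ?case using word[OF g] by simp
    next
      case (diff u v)
      then have uv: "Poly_Mapping.keys u \<subseteq> W" "Poly_Mapping.keys v \<subseteq> W" by simp_all
      show ?case
        using V_span_diff[OF B(2) act_closed[OF gM keysW_diff[OF uv]], of "g \<bullet>\<bullet> v"] act_diff[OF gM uv] diff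
          keysW_diff[OF uv] by simp
    qed
    then show ?thesis ..
  qed
  \<comment> \<open>The span of \<open>B\<close> is only known to be a subspace over
    \<open>K\<close>. The elements whose multiples by the whole ring lie in it form a submodule over
    the tensor algebra, so finite generation can be applied to them.\<close>
  define P where "P = {x \<in> carrier M. \<forall>u. Poly_Mapping.keys u \<subseteq> W \<longrightarrow> x \<bullet>\<bullet> u \<in> V.span B}"
  have "rsubmodule T M P"
    unfolding M.rsubmodule_iff
  proof (intro conjI ballI)
    show "\<zero>\<^bsub>M\<^esub> \<in> P" using V_span(3)[OF B(2)] by (simp add: P_def M.ract_zero_left cs_closed)
  next
    fix x y assume "x \<in> P" "y \<in> P"
    then show "x \<oplus>\<^bsub>M\<^esub> y \<in> P" using V_span(4)[OF B(2)] by (simp add: P_def M.ract_add_left cs_closed)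
  next
    fix x a assume x: "x \<in> P" and "a \<in> carrier T"
    then obtain v where v: "a = cs v" "Poly_Mapping.keys v \<subseteq> W" by (auto simp: T_carrier)
    have "x \<bullet>\<bullet> v \<bullet>\<bullet> u \<in> V.span B" if u: "Poly_Mapping.keys u \<subseteq> W" for u
    proof -
      have "x \<bullet>\<bullet> tm v u \<in> V.span B" using x tm_closed[OF v(2) u] by (simp add: P_def)
      then show ?thesis using act_mult[OF _ v(2) u, of x] x by (simp add: P_def)
    qed
    then show "x \<triangleleft>\<^bsub>M\<^esub> a \<in> P" using x v act_closed by (simp add: P_def)
  qed (simp add: P_def)
  moreover have "X \<subseteq> P" using gen X(2) by (auto simp: P_def)
  ultimately have P: "P = carrier M" by (rule X(3))
  have "x \<in> V.span B" if "x \<in> carrier M" for x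
  proof -
    have "x \<bullet>\<bullet> T1 \<in> V.span B" using that T1_keys unfolding P[symmetric] by (simp add: P_def)
    then show ?thesis using M.ract_one[OF that] by (simp add: T_one)
  qed
  then have "V.span B = carrier V" using V_span(1)[OF B(2)] by auto
  then show ?thesis using B unfolding V.fin_dim_def by auto
qed

end

end

section \<open>Nilpotency and finite generation of the modules that occur\<close>

context right_module
begin

lemma acts_nilpotently_submodule:
  assumes "acts_nilpotently I M" "rsubmodule A M N"
  shows "acts_nilpotently I (M\<lparr>carrier := N\<rparr>)"
  using assms unfolding acts_nilpotently_def rsubmodule_iff by (auto simp: subset_iff)

lemma acts_nilpotently_quot:
  assumes nil: "acts_nilpotently I M" and I: "I \<subseteq> carrier A" and N: "rsubmodule A M N"
  shows "acts_nilpotently I (quot_rmodule M N)"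
proof -
  obtain k where k: "\<And>x rs. x \<in> carrier M \<Longrightarrow> length rs = k \<Longrightarrow> set rs \<subseteq> I \<Longrightarrow>
      foldl (ract M) x rs = \<zero>\<^bsub>M\<^esub>"
    using nil unfolding acts_nilpotently_def by blast
  have "foldl (ract (quot_rmodule M N)) C rs = \<zero>\<^bsub>quot_rmodule M N\<^esub>"
    if C: "C \<in> carrier (quot_rmodule M N)" and rs: "length rs = k" "set rs \<subseteq> I" for C rs
  proof -
    obtain x where x: "x \<in> carrier M" "C = N +>\<^bsub>M\<^esub> x" using C unfolding quot_carrier[OF N] by blast
    show ?thesis unfolding x(2) using quot_foldl[OF N x(1), of rs] k[OF x(1) rs] rs I
      by (simp add: quot_zero[OF N])
  qed
  then show ?thesis unfolding acts_nilpotently_def by blast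
qed

text \<open>Nilpotency is pulled back along \<open>h\<close>: iterated actions commute with
  \<open>h\<close>, and injectivity reflects zero. In \<open>nmod_simple_iso\<close> the source is
  the quotient of the regular module.\<close>

lemma acts_nilpotently_iso:
  assumes X: "right_module A X" and iso: "rmodule_iso A M X"
    and nil: "acts_nilpotently I X" and I: "I \<subseteq> carrier A"
  shows "acts_nilpotently I M"
proof -
  obtain h where h: "bij_betw h (carrier M) (carrier X)"
    "\<And>x y. x \<in> carrier M \<Longrightarrow> y \<in> carrier M \<Longrightarrow> h (x \<oplus>\<^bsub>M\<^esub> y) = h x \<oplus>\<^bsub>X\<^esub> h y"
    "\<And>x a. x \<in> carrier M \<Longrightarrow> a \<in> carrier A \<Longrightarrow> h (x \<triangleleft>\<^bsub>M\<^esub> a) = h x \<triangleleft>\<^bsub>X\<^esub> a"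
    using iso by (auto simp: rmodule_iso_def)
  have hc: "h x \<in> carrier X" if "x \<in> carrier M" for x using h(1) that by (auto simp: bij_betw_def)
  have h0: "h \<zero>\<^bsub>M\<^esub> = \<zero>\<^bsub>X\<^esub>" by (rule hom_zero[OF X]) (simp_all only: hc M.zero_closed h)
  have fold: "h (foldl (ract M) x rs) = foldl (ract X) (h x) rs" if "x \<in> carrier M" "set rs \<subseteq> I" for x rs
    using that by (induction rs arbitrary: x) (use I in \<open>auto simp: h(3) ract_closed subset_iff\<close>)
  obtain k where k: "\<And>x rs. x \<in> carrier X \<Longrightarrow> length rs = k \<Longrightarrow> set rs \<subseteq> I \<Longrightarrow>
      foldl (ract X) x rs = \<zero>\<^bsub>X\<^esub>"
    using nil unfolding acts_nilpotently_def by blast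
  have "foldl (ract M) x rs = \<zero>\<^bsub>M\<^esub>" if x: "x \<in> carrier M" and rs: "length rs = k" "set rs \<subseteq> I" for x rs
  proof -
    have "h (foldl (ract M) x rs) = h \<zero>\<^bsub>M\<^esub>" using fold[OF x rs(2)] k[OF hc[OF x] rs] h0 by simp
    moreover have "foldl (ract M) x rs \<in> carrier M" using foldl_ract_closed[OF x] rs I by blast
    ultimately show ?thesis using h(1) unfolding bij_betw_def by (meson M.zero_closed inj_onD)
  qed
  then show ?thesis unfolding acts_nilpotently_def by blast
qed

end

text \<open>The coset of 1 generates, since acting on it by \<open>a\<close> gives the coset of
  \<open>a\<close>.\<close>

lemma (in ring) fin_gen_quot_regular:
  assumes I: "rsubmodule R (regular_rmodule R) I"
  shows "rmodule_fin_gen R (quot_rmodule (regular_rmodule R) I)"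
proof -
  interpret M: right_module R "regular_rmodule R" by (rule right_module_regular)
  let ?Q = "quot_rmodule (regular_rmodule R) I" and ?\<pi> = "\<lambda>x. I +>\<^bsub>regular_rmodule R\<^esub> x"
  interpret Q: right_module R ?Q by (rule M.right_module_quot[OF I])
  have "N = carrier ?Q" if N: "rsubmodule R ?Q N" and gen: "{?\<pi> \<one>} \<subseteq> N" for N
  proof
    show "N \<subseteq> carrier ?Q" using N by (simp add: Q.rsubmodule_iff)
    show "carrier ?Q \<subseteq> N"
    proof
      fix C assume "C \<in> carrier ?Q"
      then obtain a where a: "a \<in> carrier R" "C = ?\<pi> a" unfolding M.quot_carrier[OF I] by auto
      then have "C = ?\<pi> \<one> \<triangleleft>\<^bsub>?Q\<^esub> a" using M.quot_ract[OF I, of \<one> a] by simp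
      then show "C \<in> N" using N gen a(1) unfolding Q.rsubmodule_iff by simp
    qed
  qed
  moreover have "{?\<pi> \<one>} \<subseteq> carrier ?Q" unfolding M.quot_carrier[OF I] by simp
  ultimately show ?thesis unfolding rmodule_fin_gen_def by (intro exI[of _ "{?\<pi> \<one>}"]) simp
qed

lemma (in modulated_quiver) radical_subset: "tensor_radical F E \<subseteq> carrier T"
  unfolding tensor_radical_def T_carrier by auto

text \<open>The radical need not act nilpotently on the regular module, for instance when the quiver
  has a loop. So nilpotency of the quotient model is taken over from \<open>Y\<close> through the
  isomorphism, while its finite generation comes from the unit of the ring.\<close>

lemma (in modulated_quiver) nmod_simple_iso:
  assumes S: "nmod_simples F E S" and Y: "right_module T Y" "rmodule_simple T Y"
    and nil: "acts_nilpotently (tensor_radical F E) Y"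
  shows "\<exists>i. rmodule_iso T Y (S i)"
proof -
  interpret T: ring T by (rule tensor_algebra_ring)
  interpret Y: right_module T Y by fact
  obtain I where I: "rsubmodule T (regular_rmodule T) I"
    "rmodule_iso T (quot_rmodule (regular_rmodule T) I) Y"
    "rmodule_simple T (quot_rmodule (regular_rmodule T) I)"
    by (rule Y.simple_cyclic[OF Y(2)])
  interpret Q: right_module T "quot_rmodule (regular_rmodule T) I"
    by (rule right_module.right_module_quot[OF T.right_module_regular I(1)])
  have "nmod_object F E (quot_rmodule (regular_rmodule T) I)"
    using Q.right_module_axioms T.fin_gen_quot_regular[OF I(1)]
      Q.acts_nilpotently_iso[OF Y(1) I(2) nil radical_subset]
    by (simp add: nmod_object_def)
  then obtain i where "rmodule_iso T (quot_rmodule (regular_rmodule T) I) (S i)"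
    using S I(3) unfolding nmod_simples_def by blast
  then show ?thesis using rmodule_iso_trans[OF Q.rmodule_iso_sym[OF I(2)]] by blast
qed


section \<open>The stability criterion in both categories\<close>

proposition mod_stability_path_criterion:
  fixes \<Lambda> :: "('k, 'a) module" and M :: "('a, 'm) rmodule"
  assumes \<Lambda>: "fd_algebra K \<Lambda>" and S: "mod_simples K \<Lambda> S" and M: "mod_object K \<Lambda> M"
    and nonzero: "carrier M \<noteq> {\<zero>\<^bsub>M\<^esub>}" and Z: "linear_stability a b Z"
  shows "semistable \<Lambda> S Z M \<longleftrightarrow> (\<exists>t. stability_path a b t \<in> stab_domain \<Lambda> S M)"
    and "stable \<Lambda> S Z M \<longleftrightarrow> (\<exists>t. stability_path a b t \<in> int_stab_domain \<Lambda> S M)"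
    and "\<forall>t. stability_path a b t \<in> stab_domain \<Lambda> S M \<longrightarrow> t = slope \<Lambda> S Z M"
    and "\<forall>t. stability_path a b t \<in> int_stab_domain \<Lambda> S M \<longrightarrow> t = slope \<Lambda> S Z M"
proof -
  interpret fd_algebra K \<Lambda> by (rule \<Lambda>)
  interpret M: right_module \<Lambda> M using M by (simp add: mod_object_def)
  have "vectorspace.fin_dim K (restrict_scalars (\<lambda>k. k \<odot>\<^bsub>\<Lambda>\<^esub> \<one>\<^bsub>\<Lambda>\<^esub>) M)"
    using M by (simp add: mod_object_def right_scalars_eq)
  then obtain d :: "'m set \<Rightarrow> nat" where
    d: "\<And>P Q. rsubmodule \<Lambda> M P \<Longrightarrow> rsubmodule \<Lambda> M Q \<Longrightarrow> P \<subset> Q \<Longrightarrow> d P < d Q"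
    by (rule M.strict_mono_on_rsubmodules[OF field_axioms scalar_hom]) auto
  have simples: "\<exists>i. rmodule_iso \<Lambda> (quot_rmodule (M\<lparr>carrier := N\<rparr>) L) (S i)"
    if "rsubmodule \<Lambda> M N" "rsubmodule \<Lambda> M L" "L \<subseteq> N"
      "rmodule_simple \<Lambda> (quot_rmodule (M\<lparr>carrier := N\<rparr>) L)" for N L
    using that M.rsubmodule_restrict_iff[OF that(1)]
      right_module.right_module_quot[OF M.right_module_rsubmodule[OF that(1)]]
    by (intro mod_simple_iso[OF \<Lambda> S]) auto
  note criterion = stability_path_criterion[OF M.right_module_axioms nonzero d simples Z]
  show "semistable \<Lambda> S Z M \<longleftrightarrow> (\<exists>t. stability_path a b t \<in> stab_domain \<Lambda> S M)"
    and "stable \<Lambda> S Z M \<longleftrightarrow> (\<exists>t. stability_path a b t \<in> int_stab_domain \<Lambda> S M)"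
    and "\<forall>t. stability_path a b t \<in> stab_domain \<Lambda> S M \<longrightarrow> t = slope \<Lambda> S Z M"
    and "\<forall>t. stability_path a b t \<in> int_stab_domain \<Lambda> S M \<longrightarrow> t = slope \<Lambda> S Z M"
    by (rule criterion; assumption)+
qed

proposition nmod_stability_path_criterion:
  fixes F :: "'n::finite \<Rightarrow> ('k, 'f) module" and E :: "'n \<Rightarrow> 'n \<Rightarrow> ('f, 'e) bimodule"
    and M :: "((('n, 'f, 'e) tensor_word \<Rightarrow>\<^sub>0 int) set, 'm) rmodule"
  defines "T \<equiv> tensor_algebra F E"
  assumes Q: "modulated_quiver K F E" and S: "nmod_simples F E S" and M: "nmod_object F E M"
    and nonzero: "carrier M \<noteq> {\<zero>\<^bsub>M\<^esub>}" and Z: "linear_stability a b Z"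
  shows "semistable T S Z M \<longleftrightarrow> (\<exists>t. stability_path a b t \<in> stab_domain T S M)"
    and "stable T S Z M \<longleftrightarrow> (\<exists>t. stability_path a b t \<in> int_stab_domain T S M)"
    and "\<forall>t. stability_path a b t \<in> stab_domain T S M \<longrightarrow> t = slope T S Z M"
    and "\<forall>t. stability_path a b t \<in> int_stab_domain T S M \<longrightarrow> t = slope T S Z M"
proof -
  interpret Q: modulated_quiver K F E by (rule Q)
  interpret M: right_module T M using M by (simp add: nmod_object_def T_def)
  have nil: "acts_nilpotently (tensor_radical F E) M" using M by (simp add: nmod_object_def)
  have "vectorspace.fin_dim K (restrict_scalars (\<lambda>k. Q.cs (Q.diag k)) M)"
    by (rule Q.nilpotent_fin_dim) (use M in \<open>simp_all add: nmod_object_def\<close>)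
  then obtain d :: "'m set \<Rightarrow> nat" where
    d: "\<And>P Q. rsubmodule T M P \<Longrightarrow> rsubmodule T M Q \<Longrightarrow> P \<subset> Q \<Longrightarrow> d P < d Q"
    by (rule M.strict_mono_on_rsubmodules[OF Q.field_axioms Q.diag_ring_hom[folded T_def]]) auto
  \<comment> \<open>A subquotient of \<open>M\<close> inherits the nilpotent action first as a
    submodule and then as a quotient, as \<open>nmod_simple_iso\<close> requires.\<close>
  have simples: "\<exists>i. rmodule_iso T (quot_rmodule (M\<lparr>carrier := N\<rparr>) L) (S i)"
    if N: "rsubmodule T M N" and L: "rsubmodule T M L" "L \<subseteq> N"
      and simple: "rmodule_simple T (quot_rmodule (M\<lparr>carrier := N\<rparr>) L)" for N L
  proof -
    interpret N: right_module T "M\<lparr>carrier := N\<rparr>" by (rule M.right_module_rsubmodule[OF N])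
    have L': "rsubmodule T (M\<lparr>carrier := N\<rparr>) L" using M.rsubmodule_restrict_iff[OF N] L by simp
    show ?thesis
      using Q.nmod_simple_iso[OF S] N.right_module_quot[OF L'] simple
        N.acts_nilpotently_quot[OF M.acts_nilpotently_submodule[OF nil N] _ L'] Q.radical_subset
      unfolding T_def by blast
  qed
  note criterion = stability_path_criterion[OF M.right_module_axioms nonzero d simples Z]
  show "semistable T S Z M \<longleftrightarrow> (\<exists>t. stability_path a b t \<in> stab_domain T S M)"
    and "stable T S Z M \<longleftrightarrow> (\<exists>t. stability_path a b t \<in> int_stab_domain T S M)"
    and "\<forall>t. stability_path a b t \<in> stab_domain T S M \<longrightarrow> t = slope T S Z M"
    and "\<forall>t. stability_path a b t \<in> int_stab_domain T S M \<longrightarrow> t = slope T S Z M"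
    by (rule criterion; assumption)+
qed

theorem theorem1p4:
  fixes K :: "('k, 'kx) ring_scheme"
    and a b :: "real ^ 'n::finite"
    and Z :: "int ^ 'n \<Rightarrow> complex"
    and \<Lambda> :: "('k, 'a) module"
    and S :: "'n \<Rightarrow> ('a, 's) rmodule"
    and M :: "('a, 'm) rmodule"
    and F :: "'n \<Rightarrow> ('k, 'f) module"
    and E :: "'n \<Rightarrow> 'n \<Rightarrow> ('f, 'e) bimodule"
    and S' :: "'n \<Rightarrow> ((('n, 'f, 'e) tensor_word \<Rightarrow>\<^sub>0 int) set, 't) rmodule"
    and M' :: "((('n, 'f, 'e) tensor_word \<Rightarrow>\<^sub>0 int) set, 'l) rmodule"
  assumes "field K"
    and "linear_stability a b Z"
  shows
    "(fd_algebra K \<Lambda> \<and> mod_simples K \<Lambda> S \<and> mod_object K \<Lambda> M \<and> carrier M \<noteq> {\<zero>\<^bsub>M\<^esub>} \<longrightarrow>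
        (semistable \<Lambda> S Z M \<longleftrightarrow> (\<exists>t. stability_path a b t \<in> stab_domain \<Lambda> S M)) \<and>
        (stable \<Lambda> S Z M \<longleftrightarrow> (\<exists>t. stability_path a b t \<in> int_stab_domain \<Lambda> S M)) \<and>
        (\<forall>t. stability_path a b t \<in> stab_domain \<Lambda> S M \<longrightarrow> t = slope \<Lambda> S Z M) \<and>
        (\<forall>t. stability_path a b t \<in> int_stab_domain \<Lambda> S M \<longrightarrow> t = slope \<Lambda> S Z M))
     \<and>
     (modulated_quiver K F E \<and> nmod_simples F E S' \<and> nmod_object F E M' \<and>
        carrier M' \<noteq> {\<zero>\<^bsub>M'\<^esub>} \<longrightarrow>
        (semistable (tensor_algebra F E) S' Z M' \<longleftrightarrow>
           (\<exists>t. stability_path a b t \<in> stab_domain (tensor_algebra F E) S' M')) \<and>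
        (stable (tensor_algebra F E) S' Z M' \<longleftrightarrow>
           (\<exists>t. stability_path a b t \<in> int_stab_domain (tensor_algebra F E) S' M')) \<and>
        (\<forall>t. stability_path a b t \<in> stab_domain (tensor_algebra F E) S' M'
           \<longrightarrow> t = slope (tensor_algebra F E) S' Z M') \<and>
        (\<forall>t. stability_path a b t \<in> int_stab_domain (tensor_algebra F E) S' M'
           \<longrightarrow> t = slope (tensor_algebra F E) S' Z M'))"
  by (intro conjI impI; elim conjE;
      rule mod_stability_path_criterion[OF _ _ _ _ assms(2)]
        nmod_stability_path_criterion[OF _ _ _ _ assms(2)]; assumption)

end
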